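(* Let $A$ be a Lie algebra over a field $k$ and let $B$ be an $A$-Lie algebra. Then the category $\mathrm{AS}_{A,B}$ of algebraic sets over $B$ is equivalent (the correspondence being given by contravariant functors) to the category $\mathrm{CA}_{A,B}$ of coordinate algebras over $B$.
   Context: An $A$-Lie algebra is a Lie algebra $B$ over $k$ together with a fixed embedding of Lie algebras $A\to B$, via which $A$ is identified with a subalgebra of $B$. An $A$-homomorphism of $A$-Lie algebras is a homomorphism of Lie algebras that is the identity on $A$; $\mathrm{Hom}_A(C,D)$ denotes the set of $A$-homomorphisms from $C$ to $D$. For $X=\{x_1,\dots,x_n\}$, $A[X]=A*F(X)$ is the free Lie product of $A$ and the free Lie $k$-algebra $F(X)$. For $f\in A[X]$ and $p=(b_1,\dots,b_n)\in B^n$, $f(p)$ is the image of $f$ under the $A$-homomorphism $A[X]\to B$ with $x_i\mapsto b_i$. For $S\subseteq A[X]$, $V_B(S)=\{p\in B^n : f(p)=0\ \forall f\in S\}$; sets of this form are called algebraic sets over $B$. For $Y\subseteq B^n$, $\mathrm{Rad}_B(Y)=\{f\in A[X] : f(p)=0\ \forall p\in Y\}$ (so $\mathrm{Rad}_B(\emptyset)=A[X]$), an ideal of $A[X]$. The coordinate algebra of an algebraic set $Y=V_B(S)\subseteq B^n$ is $\Gamma_B(Y)=\Gamma_B(S)=A[X]/\mathrm{Rad}_B(Y)$; if $Y=\emptyset$ it is $0$, and if $Y\neq\emptyset$ it is an $A$-Lie algebra. Category $\mathrm{AS}_{A,B}$: objects are the algebraic sets in all the affine spaces $B^n$, $n\in\mathbb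 N$. A morphism from $Y\subseteq B^n$ to $Z\subseteq B^m$ is a map $\psi:Y\to Z$ for which there exist $f_1,\dots,f_m\in A[x_1,\dots,x_n]$ with $\psi(p)=(f_1(p),\dots,f_m(p))$ for all $p\in Y$. Category $\mathrm{CA}_{A,B}$: objects are the coordinate algebras of all algebraic sets from $\mathrm{AS}_{A,B}$; morphisms are $A$-homomorphisms. If the empty set is an algebraic set, then the zero algebra is a coordinate algebra, and by convention $\mathrm{Hom}_A(0,\Gamma_B(S))=\mathrm{Hom}_A(\Gamma_B(S),0)=\emptyset$ for the coordinate algebras $\Gamma_B(S)$ of nonempty algebraic sets.
   Formalization: In the category of algebraic sets, the empty map from the empty algebraic set to a nonempty one is not counted as a morphism; with it and the stated convention on Hom_A with the zero algebra, the claim fails whenever A is nonzero. *)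

theory Defs
  imports "HOL-Algebra.Module" "HOL-Algebra.QuotRing"
begin

section \<open>Lie algebras over a field\<close>

text \<open>
  A Lie algebra is carried by the library's \<open>module\<close> record. The field \<open>mult\<close> holds the Lie bracket,
  so \<open>x \<otimes>\<^bsub>L\<^esub> y\<close> stands for \<open>[x, y]\<close>. The field \<open>one\<close> has no meaning.
\<close>

locale lie_algebra = field K + module K L for K (structure) and L (structure) +
  assumes bracket_closed:
      "\<lbrakk>x \<in> carrier L; y \<in> carrier L\<rbrakk> \<Longrightarrow> x \<otimes>\<^bsub>L\<^esub> y \<in> carrier L"
    and bracket_add_left:
      "\<lbrakk>x \<in> carrier L; y \<in> carrier L; z \<in> carrier L\<rbrakk>
        \<Longrightarrow> (x \<oplus>\<^bsub>L\<^esub> y) \<otimes>\<^bsub>L\<^esub> z = (x \<otimes>\<^bsub>L\<^esub> z) \<oplus>\<^bsub>L\<^esub> (y \<otimes>\<^bsub>L\<^esub> z)"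
    and bracket_add_right:
      "\<lbrakk>x \<in> carrier L; y \<in> carrier L; z \<in> carrier L\<rbrakk>
        \<Longrightarrow> x \<otimes>\<^bsub>L\<^esub> (y \<oplus>\<^bsub>L\<^esub> z) = (x \<otimes>\<^bsub>L\<^esub> y) \<oplus>\<^bsub>L\<^esub> (x \<otimes>\<^bsub>L\<^esub> z)"
    and bracket_smult_left:
      "\<lbrakk>c \<in> carrier K; x \<in> carrier L; y \<in> carrier L\<rbrakk>
        \<Longrightarrow> (c \<odot>\<^bsub>L\<^esub> x) \<otimes>\<^bsub>L\<^esub> y = c \<odot>\<^bsub>L\<^esub> (x \<otimes>\<^bsub>L\<^esub> y)"
    and bracket_smult_right:
      "\<lbrakk>c \<in> carrier K; x \<in> carrier L; y \<in> carrier L\<rbrakk>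
        \<Longrightarrow> x \<otimes>\<^bsub>L\<^esub> (c \<odot>\<^bsub>L\<^esub> y) = c \<odot>\<^bsub>L\<^esub> (x \<otimes>\<^bsub>L\<^esub> y)"
    and bracket_self:
      "x \<in> carrier L \<Longrightarrow> x \<otimes>\<^bsub>L\<^esub> x = \<zero>\<^bsub>L\<^esub>"
    and jacobi:
      "\<lbrakk>x \<in> carrier L; y \<in> carrier L; z \<in> carrier L\<rbrakk>
        \<Longrightarrow> (x \<otimes>\<^bsub>L\<^esub> (y \<otimes>\<^bsub>L\<^esub> z)) \<oplus>\<^bsub>L\<^esub> (y \<otimes>\<^bsub>L\<^esub> (z \<otimes>\<^bsub>L\<^esub> x)) \<oplus>\<^bsub>L\<^esub> (z \<otimes>\<^bsub>L\<^esub> (x \<otimes>\<^bsub>L\<^esub> y)) = \<zero>\<^bsub>L\<^esub>"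

text \<open>Homomorphisms are extensional functions, so that they are determined by their values on the carrier.\<close>

definition lie_hom ::
    "('k, 'm) ring_scheme \<Rightarrow> ('k, 'c, 'p) module_scheme \<Rightarrow> ('k, 'd, 'q) module_scheme \<Rightarrow> ('c \<Rightarrow> 'd) set"
  where "lie_hom K C D =
    {h \<in> carrier C \<rightarrow>\<^sub>E carrier D.
      (\<forall>x \<in> carrier C. \<forall>y \<in> carrier C. h (x \<oplus>\<^bsub>C\<^esub> y) = h x \<oplus>\<^bsub>D\<^esub> h y) \<and>
      (\<forall>c \<in> carrier K. \<forall>x \<in> carrier C. h (c \<odot>\<^bsub>C\<^esub> x) = c \<odot>\<^bsub>D\<^esub> h x) \<and>
      (\<forall>x \<in> carrier C. \<forall>y \<in> carrier C. h (x \<otimes>\<^bsub>C\<^esub> y) = h x \<otimes>\<^bsub>D\<^esub> h y)}"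

section \<open>Lie algebras over a fixed Lie algebra\<close>

text \<open>
  For an \<open>A\<close>-Lie algebra \<open>B\<close> the field \<open>emb B\<close> is the embedding of \<open>A\<close>. Injectivity is required by
  \<open>A_lie_algebra\<close> only, so that the zero coordinate algebra of the empty set fits the same record type.
\<close>

record ('k, 'b, 'a) alie = "('k, 'b) module" +
  emb :: "'a \<Rightarrow> 'b"

definition A_lie_algebra ::
    "('k, 'm) ring_scheme \<Rightarrow> ('k, 'a, 'p) module_scheme \<Rightarrow> ('k, 'b, 'a, 'q) alie_scheme \<Rightarrow> bool"
  where "A_lie_algebra K A B \<longleftrightarrow>
    lie_algebra K A \<and> lie_algebra K B \<and>
    restrict (emb B) (carrier A) \<in> lie_hom K A B \<and> inj_on (emb B) (carrier A)"

definition A_hom ::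
    "('k, 'm) ring_scheme \<Rightarrow> ('k, 'a, 'p) module_scheme \<Rightarrow>
      ('k, 'c, 'a, 'q) alie_scheme \<Rightarrow> ('k, 'd, 'a, 'r) alie_scheme \<Rightarrow> ('c \<Rightarrow> 'd) set"
  where "A_hom K A C D = {h \<in> lie_hom K C D. \<forall>a \<in> carrier A. h (emb C a) = emb D a}"

section \<open>Presentations, free Lie algebras and free Lie products\<close>

datatype ('k, 'g) lie_term =
    Gen 'g
  | Zero
  | Add "('k, 'g) lie_term" "('k, 'g) lie_term"
  | Scale 'k "('k, 'g) lie_term"
  | Bracket "('k, 'g) lie_term" "('k, 'g) lie_term"

inductive_set lie_terms :: "('k, 'm) ring_scheme \<Rightarrow> 'g set \<Rightarrow> ('k, 'g) lie_term set"
  for K and G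
  where
    Gen: "g \<in> G \<Longrightarrow> Gen g \<in> lie_terms K G"
  | Zero: "Zero \<in> lie_terms K G"
  | Add: "\<lbrakk>s \<in> lie_terms K G; t \<in> lie_terms K G\<rbrakk> \<Longrightarrow> Add s t \<in> lie_terms K G"
  | Scale: "\<lbrakk>c \<in> carrier K; t \<in> lie_terms K G\<rbrakk> \<Longrightarrow> Scale c t \<in> lie_terms K G"
  | Bracket: "\<lbrakk>s \<in> lie_terms K G; t \<in> lie_terms K G\<rbrakk> \<Longrightarrow> Bracket s t \<in> lie_terms K G"

text \<open>
  The least congruence on the terms over \<open>G\<close> that contains the relations \<open>R\<close> and makes the quotient
  a Lie algebra over \<open>K\<close>.
\<close>

inductive_set lie_cong ::
    "('k, 'm) ring_scheme \<Rightarrow> 'g set \<Rightarrow> ('k, 'g) lie_term rel \<Rightarrow> ('k, 'g) lie_term rel"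
  for K (structure) and G and R
  where
    rel: "\<lbrakk>(s, t) \<in> R; s \<in> lie_terms K G; t \<in> lie_terms K G\<rbrakk> \<Longrightarrow> (s, t) \<in> lie_cong K G R"
  | refl: "t \<in> lie_terms K G \<Longrightarrow> (t, t) \<in> lie_cong K G R"
  | sym: "(s, t) \<in> lie_cong K G R \<Longrightarrow> (t, s) \<in> lie_cong K G R"
  | trans: "\<lbrakk>(s, t) \<in> lie_cong K G R; (t, u) \<in> lie_cong K G R\<rbrakk> \<Longrightarrow> (s, u) \<in> lie_cong K G R"
  | cong_Add: "\<lbrakk>(s, s') \<in> lie_cong K G R; (t, t') \<in> lie_cong K G R\<rbrakk>
      \<Longrightarrow> (Add s t, Add s' t') \<in> lie_cong K G R"
  | cong_Scale: "\<lbrakk>c \<in> carrier K; (t, t') \<in> lie_cong K G R\<rbrakk>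
      \<Longrightarrow> (Scale c t, Scale c t') \<in> lie_cong K G R"
  | cong_Bracket: "\<lbrakk>(s, s') \<in> lie_cong K G R; (t, t') \<in> lie_cong K G R\<rbrakk>
      \<Longrightarrow> (Bracket s t, Bracket s' t') \<in> lie_cong K G R"
  | add_assoc: "\<lbrakk>s \<in> lie_terms K G; t \<in> lie_terms K G; u \<in> lie_terms K G\<rbrakk>
      \<Longrightarrow> (Add (Add s t) u, Add s (Add t u)) \<in> lie_cong K G R"
  | add_comm: "\<lbrakk>s \<in> lie_terms K G; t \<in> lie_terms K G\<rbrakk>
      \<Longrightarrow> (Add s t, Add t s) \<in> lie_cong K G R"
  | add_zero: "t \<in> lie_terms K G \<Longrightarrow> (Add Zero t, t) \<in> lie_cong K G R"
  | add_neg: "t \<in> lie_terms K G \<Longrightarrow> (Add (Scale (\<ominus> \<one>) t) t, Zero) \<in> lie_cong K G R"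
  | scale_add: "\<lbrakk>c \<in> carrier K; s \<in> lie_terms K G; t \<in> lie_terms K G\<rbrakk>
      \<Longrightarrow> (Scale c (Add s t), Add (Scale c s) (Scale c t)) \<in> lie_cong K G R"
  | add_scale: "\<lbrakk>c \<in> carrier K; d \<in> carrier K; t \<in> lie_terms K G\<rbrakk>
      \<Longrightarrow> (Scale (c \<oplus> d) t, Add (Scale c t) (Scale d t)) \<in> lie_cong K G R"
  | scale_scale: "\<lbrakk>c \<in> carrier K; d \<in> carrier K; t \<in> lie_terms K G\<rbrakk>
      \<Longrightarrow> (Scale (c \<otimes> d) t, Scale c (Scale d t)) \<in> lie_cong K G R"
  | scale_one: "t \<in> lie_terms K G \<Longrightarrow> (Scale \<one> t, t) \<in> lie_cong K G R"
  | bracket_add_left: "\<lbrakk>s \<in> lie_terms K G; t \<in> lie_terms K G; u \<in> lie_terms K G\<rbrakk>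
      \<Longrightarrow> (Bracket (Add s t) u, Add (Bracket s u) (Bracket t u)) \<in> lie_cong K G R"
  | bracket_add_right: "\<lbrakk>s \<in> lie_terms K G; t \<in> lie_terms K G; u \<in> lie_terms K G\<rbrakk>
      \<Longrightarrow> (Bracket s (Add t u), Add (Bracket s t) (Bracket s u)) \<in> lie_cong K G R"
  | bracket_scale_left: "\<lbrakk>c \<in> carrier K; s \<in> lie_terms K G; t \<in> lie_terms K G\<rbrakk>
      \<Longrightarrow> (Bracket (Scale c s) t, Scale c (Bracket s t)) \<in> lie_cong K G R"
  | bracket_scale_right: "\<lbrakk>c \<in> carrier K; s \<in> lie_terms K G; t \<in> lie_terms K G\<rbrakk>
      \<Longrightarrow> (Bracket s (Scale c t), Scale c (Bracket s t)) \<in> lie_cong K G R"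
  | bracket_self: "t \<in> lie_terms K G \<Longrightarrow> (Bracket t t, Zero) \<in> lie_cong K G R"
  | jacobi: "\<lbrakk>s \<in> lie_terms K G; t \<in> lie_terms K G; u \<in> lie_terms K G\<rbrakk>
      \<Longrightarrow> (Add (Add (Bracket s (Bracket t u)) (Bracket t (Bracket u s))) (Bracket u (Bracket s t)), Zero)
          \<in> lie_cong K G R"

text \<open>The Lie algebra over \<open>K\<close> with generators \<open>G\<close> and relations \<open>R\<close>.\<close>

definition lie_presentation ::
    "('k, 'm) ring_scheme \<Rightarrow> 'g set \<Rightarrow> ('k, 'g) lie_term rel \<Rightarrow> ('k, ('k, 'g) lie_term set) module"
  where "lie_presentation K G R =
    \<lparr>carrier = lie_terms K G // lie_cong K G R,
     mult = (\<lambda>C D. \<Union>s\<in>C. \<Union>t\<in>D. lie_cong K G R `` {Bracket s t}),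
     one = lie_cong K G R `` {Zero},
     zero = lie_cong K G R `` {Zero},
     add = (\<lambda>C D. \<Union>s\<in>C. \<Union>t\<in>D. lie_cong K G R `` {Add s t}),
     smult = (\<lambda>c D. \<Union>t\<in>D. lie_cong K G R `` {Scale c t})\<rparr>"

definition free_lie_algebra ::
    "('k, 'm) ring_scheme \<Rightarrow> 'x set \<Rightarrow> ('k, ('k, 'x) lie_term set) module"
  where "free_lie_algebra K X = lie_presentation K X {}"

definition free_lie_gen ::
    "('k, 'm) ring_scheme \<Rightarrow> 'x set \<Rightarrow> 'x \<Rightarrow> ('k, 'x) lie_term set"
  where "free_lie_gen K X x = lie_cong K X {} `` {Gen x}"

text \<open>The relations that make \<open>x \<mapsto> Gen (i x)\<close> a homomorphism on \<open>L\<close>.\<close>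

definition hom_relations ::
    "('k, 'm) ring_scheme \<Rightarrow> ('k, 'l, 'p) module_scheme \<Rightarrow> ('l \<Rightarrow> 'g) \<Rightarrow> ('k, 'g) lie_term rel"
  where "hom_relations K L i =
    {(Gen (i (x \<oplus>\<^bsub>L\<^esub> y)), Add (Gen (i x)) (Gen (i y))) | x y. x \<in> carrier L \<and> y \<in> carrier L} \<union>
    {(Gen (i (c \<odot>\<^bsub>L\<^esub> x)), Scale c (Gen (i x))) | c x. c \<in> carrier K \<and> x \<in> carrier L} \<union>
    {(Gen (i (x \<otimes>\<^bsub>L\<^esub> y)), Bracket (Gen (i x)) (Gen (i y))) | x y. x \<in> carrier L \<and> y \<in> carrier L}"

definition free_product_gens ::
    "('k, 'l, 'p) module_scheme \<Rightarrow> ('k, 'n, 'q) module_scheme \<Rightarrow> ('l + 'n) set"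
  where "free_product_gens L N = carrier L <+> carrier N"

definition free_product_rels ::
    "('k, 'm) ring_scheme \<Rightarrow> ('k, 'l, 'p) module_scheme \<Rightarrow> ('k, 'n, 'q) module_scheme
      \<Rightarrow> ('k, 'l + 'n) lie_term rel"
  where "free_product_rels K L N = hom_relations K L Inl \<union> hom_relations K N Inr"

definition free_lie_product ::
    "('k, 'm) ring_scheme \<Rightarrow> ('k, 'l, 'p) module_scheme \<Rightarrow> ('k, 'n, 'q) module_scheme
      \<Rightarrow> ('k, ('k, 'l + 'n) lie_term set) module"
  where "free_lie_product K L N =
    lie_presentation K (free_product_gens L N) (free_product_rels K L N)"

definition free_product_inl ::
    "('k, 'm) ring_scheme \<Rightarrow> ('k, 'l, 'p) module_scheme \<Rightarrow> ('k, 'n, 'q) module_scheme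
      \<Rightarrow> 'l \<Rightarrow> ('k, 'l + 'n) lie_term set"
  where "free_product_inl K L N x =
    lie_cong K (free_product_gens L N) (free_product_rels K L N) `` {Gen (Inl x)}"

definition free_product_inr ::
    "('k, 'm) ring_scheme \<Rightarrow> ('k, 'l, 'p) module_scheme \<Rightarrow> ('k, 'n, 'q) module_scheme
      \<Rightarrow> 'n \<Rightarrow> ('k, 'l + 'n) lie_term set"
  where "free_product_inr K L N y =
    lie_cong K (free_product_gens L N) (free_product_rels K L N) `` {Gen (Inr y)}"

section \<open>The algebra \<open>A[X]\<close> and evaluation of its elements\<close>

type_synonym ('k, 'a) lpoly = "('k, 'a + ('k, nat) lie_term set) lie_term set"

text \<open>\<open>A[X] = A * F(X)\<close> with \<open>n\<close> variables, indexed from \<open>0\<close> to \<open>n - 1\<close>.\<close>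

definition lpoly_algebra ::
    "('k, 'm) ring_scheme \<Rightarrow> ('k, 'a, 'p) module_scheme \<Rightarrow> nat \<Rightarrow> ('k, ('k, 'a) lpoly, 'a) alie"
  where "lpoly_algebra K A n =
    module.extend (free_lie_product K A (free_lie_algebra K {..<n}))
      (alie.fields (free_product_inl K A (free_lie_algebra K {..<n})))"

definition lpoly_var ::
    "('k, 'm) ring_scheme \<Rightarrow> ('k, 'a, 'p) module_scheme \<Rightarrow> nat \<Rightarrow> nat \<Rightarrow> ('k, 'a) lpoly"
  where "lpoly_var K A n i =
    free_product_inr K A (free_lie_algebra K {..<n}) (free_lie_gen K {..<n} i)"

definition affine_space :: "('k, 'b, 'a, 'q) alie_scheme \<Rightarrow> nat \<Rightarrow> 'b list set"
  where "affine_space B n = {p. length p = n \<and> set p \<subseteq> carrier B}"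

definition lpoly_eval_hom ::
    "('k, 'm) ring_scheme \<Rightarrow> ('k, 'a, 'p) module_scheme \<Rightarrow> ('k, 'b, 'a, 'q) alie_scheme
      \<Rightarrow> nat \<Rightarrow> 'b list \<Rightarrow> ('k, 'a) lpoly \<Rightarrow> 'b"
  where "lpoly_eval_hom K A B n p =
    (THE h. h \<in> A_hom K A (lpoly_algebra K A n) B \<and> (\<forall>i<n. h (lpoly_var K A n i) = p ! i))"

definition lpoly_eval ::
    "('k, 'm) ring_scheme \<Rightarrow> ('k, 'a, 'p) module_scheme \<Rightarrow> ('k, 'b, 'a, 'q) alie_scheme
      \<Rightarrow> nat \<Rightarrow> ('k, 'a) lpoly \<Rightarrow> 'b list \<Rightarrow> 'b"
  where "lpoly_eval K A B n f p = lpoly_eval_hom K A B n p f"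

section \<open>Universal properties and uniqueness of evaluation\<close>

lemma lie_cong_terms:
  assumes "field K" and "(s, t) \<in> lie_cong K G R"
  shows "s \<in> lie_terms K G \<and> t \<in> lie_terms K G"
proof -
  interpret field K by fact
  from assms(2) show ?thesis
    by induction (auto intro: lie_terms.intros)
qed

lemma equiv_lie_cong:
  assumes "field K"
  shows "equiv (lie_terms K G) (lie_cong K G R)"
proof (rule equivI)
  show "lie_cong K G R \<subseteq> lie_terms K G \<times> lie_terms K G"
    by (auto dest: lie_cong_terms[OF assms])
  show "refl_on (lie_terms K G) (lie_cong K G R)"
    by (rule refl_onI) (rule lie_cong.refl)
  show "sym (lie_cong K G R)"
    by (rule symI) (erule lie_cong.sym)
  show "trans (lie_cong K G R)"
    by (rule transI) (rule lie_cong.trans)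
qed

lemma lie_presentation_ops:
  fixes K :: "('k, 'm) ring_scheme" and G :: "'g set" and R
  assumes K: "field K"
  defines "cl \<equiv> \<lambda>t. lie_cong K G R `` {t}"
  shows "\<And>s t. \<lbrakk>s \<in> lie_terms K G; t \<in> lie_terms K G\<rbrakk>
      \<Longrightarrow> add (lie_presentation K G R) (cl s) (cl t) = cl (Add s t)"
    and "\<And>s t. \<lbrakk>s \<in> lie_terms K G; t \<in> lie_terms K G\<rbrakk>
      \<Longrightarrow> mult (lie_presentation K G R) (cl s) (cl t) = cl (Bracket s t)"
    and "\<And>c t. \<lbrakk>c \<in> carrier K; t \<in> lie_terms K G\<rbrakk>
      \<Longrightarrow> smult (lie_presentation K G R) c (cl t) = cl (Scale c t)"
    and "zero (lie_presentation K G R) = cl Zero"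
    and "carrier (lie_presentation K G R) = cl ` lie_terms K G"
proof -
  note eq = equiv_lie_cong[OF K, of G R]
  show "add (lie_presentation K G R) (cl s) (cl t) = cl (Add s t)"
    if "s \<in> lie_terms K G" "t \<in> lie_terms K G" for s t
  proof -
    have "congruent2 (lie_cong K G R) (lie_cong K G R) (\<lambda>s t. lie_cong K G R `` {Add s t})"
      by (rule congruent2I') (rule equiv_class_eq[OF eq], rule lie_cong.cong_Add)
    from UN_equiv_class2[OF eq eq this that] show ?thesis
      by (simp add: lie_presentation_def cl_def)
  qed
  show "mult (lie_presentation K G R) (cl s) (cl t) = cl (Bracket s t)"
    if "s \<in> lie_terms K G" "t \<in> lie_terms K G" for s t
  proof -
    have "congruent2 (lie_cong K G R) (lie_cong K G R) (\<lambda>s t. lie_cong K G R `` {Bracket s t})"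
      by (rule congruent2I') (rule equiv_class_eq[OF eq], rule lie_cong.cong_Bracket)
    from UN_equiv_class2[OF eq eq this that] show ?thesis
      by (simp add: lie_presentation_def cl_def)
  qed
  show "smult (lie_presentation K G R) c (cl t) = cl (Scale c t)"
    if "c \<in> carrier K" "t \<in> lie_terms K G" for c t
  proof -
    have "congruent (lie_cong K G R) (\<lambda>t. lie_cong K G R `` {Scale c t})"
      by (rule congruentI) (rule equiv_class_eq[OF eq], rule lie_cong.cong_Scale[OF that(1)])
    from UN_equiv_class[OF eq this that(2)] show ?thesis
      by (simp add: lie_presentation_def cl_def)
  qed
  show "zero (lie_presentation K G R) = cl Zero"
    by (simp add: lie_presentation_def cl_def)
  show "carrier (lie_presentation K G R) = cl ` lie_terms K G"
    by (auto simp: lie_presentation_def cl_def quotient_def)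
qed

lemma lie_algebra_presentation:
  assumes K: "field K"
  shows "lie_algebra K (lie_presentation K G R)"
proof -
  interpret field K by fact
  let ?L = "lie_presentation K G R"
  note ops = lie_presentation_ops[OF K, where G = G and R = R]
  note eqI = equiv_class_eq[OF equiv_lie_cong[OF K, of G R]]
  note T = lie_terms.intros
  have ab: "abelian_group ?L"
  proof (rule abelian_groupI)
    fix x assume "x \<in> carrier ?L"
    then obtain t where t: "t \<in> lie_terms K G" "x = lie_cong K G R `` {t}"
      by (auto simp: ops(5))
    show "\<exists>y \<in> carrier ?L. y \<oplus>\<^bsub>?L\<^esub> x = \<zero>\<^bsub>?L\<^esub>"
      by (rule bexI[of _ "lie_cong K G R `` {Scale (\<ominus>\<^bsub>K\<^esub> \<one>\<^bsub>K\<^esub>) t}"])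
        (simp_all add: ops t T eqI[OF lie_cong.add_neg])
  qed ((clarsimp simp: ops T, (rule eqI, rule lie_cong.intros(8-); assumption))
      | (force simp: ops(1,4,5) T))+
  show ?thesis
  proof (intro lie_algebra.intro module.intro module_axioms.intro lie_algebra_axioms.intro)
    show "field K" by fact
    show "cring K" by (rule is_cring)
    show "abelian_group ?L" by (rule ab)
  qed ((clarsimp simp: ops T, (rule eqI, rule lie_cong.intros(8-); assumption))
      | (force simp: ops T))+
qed

primrec term_value ::
    "('k, 'l, 'p) module_scheme \<Rightarrow> ('g \<Rightarrow> 'l) \<Rightarrow> ('k, 'g) lie_term \<Rightarrow> 'l"
  where
    "term_value L v (Gen g) = v g"
  | "term_value L v Zero = \<zero>\<^bsub>L\<^esub>"
  | "term_value L v (Add s t) = term_value L v s \<oplus>\<^bsub>L\<^esub> term_value L v t"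
  | "term_value L v (Scale c t) = c \<odot>\<^bsub>L\<^esub> term_value L v t"
  | "term_value L v (Bracket s t) = term_value L v s \<otimes>\<^bsub>L\<^esub> term_value L v t"

lemma term_value_closed:
  assumes L: "lie_algebra K L" and v: "v \<in> G \<rightarrow> carrier L" and t: "t \<in> lie_terms K G"
  shows "term_value L v t \<in> carrier L"
proof -
  interpret lie_algebra K L by fact
  from t show ?thesis by induction (use v in \<open>auto simp: bracket_closed\<close>)
qed

lemma term_value_cong:
  assumes L: "lie_algebra K L" and v: "v \<in> G \<rightarrow> carrier L"
    and R: "\<And>s t. (s, t) \<in> R \<Longrightarrow> term_value L v s = term_value L v t"
    and st: "(s, t) \<in> lie_cong K G R"
  shows "term_value L v s = term_value L v t"
proof -
  interpret lie_algebra K L by fact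
  note cl = term_value_closed[OF L v]
  from st show ?thesis
  proof induction
    case (add_neg t)
    then show ?case
      using cl[of t] by (simp add: smult_l_minus M.l_neg)
  qed (auto simp: R cl M.a_assoc M.a_comm M.a_lcomm smult_l_distr smult_r_distr smult_assoc1
      bracket_add_left bracket_add_right bracket_smult_left bracket_smult_right
      bracket_self jacobi)
qed

lemma presentation_hom_exists:
  assumes L: "lie_algebra K L" and v: "v \<in> G \<rightarrow> carrier L"
    and R: "\<And>s t. (s, t) \<in> R \<Longrightarrow> term_value L v s = term_value L v t"
  obtains h where "h \<in> lie_hom K (lie_presentation K G R) L"
    and "\<And>t. t \<in> lie_terms K G \<Longrightarrow> h (lie_cong K G R `` {t}) = term_value L v t"
proof -
  interpret lie_algebra K L by fact
  have K: "field K" ..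
  let ?P = "lie_presentation K G R"
  note ops = lie_presentation_ops[OF K, where G = G and R = R]
  define h where "h = restrict (\<lambda>C. the_elem (term_value L v ` C)) (carrier ?P)"
  have h: "h (lie_cong K G R `` {t}) = term_value L v t" if t: "t \<in> lie_terms K G" for t
  proof -
    have "term_value L v u = term_value L v t" if "u \<in> lie_cong K G R `` {t}" for u
      using term_value_cong[OF L v R, of R t u] that by simp
    moreover have "t \<in> lie_cong K G R `` {t}"
      using lie_cong.refl[OF t, of R] by simp
    ultimately have "term_value L v ` (lie_cong K G R `` {t}) = {term_value L v t}"
      by blast
    moreover have "lie_cong K G R `` {t} \<in> carrier ?P"
      unfolding ops(5) using t by (rule imageI)
    ultimately show ?thesis by (simp add: h_def)
  qed
  have "h \<in> extensional (carrier ?P)"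
    by (simp add: h_def)
  then have "h \<in> lie_hom K ?P L"
    unfolding lie_hom_def
    by (auto simp: ops h lie_terms.intros(3-) term_value_closed[OF L v] PiE_iff)
  then show ?thesis by (rule that) (rule h)
qed

lemma presentation_hom_unique:
  assumes K: "field K" and h: "h \<in> lie_hom K (lie_presentation K G R) L"
    and h': "h' \<in> lie_hom K (lie_presentation K G R) L" and L: "lie_algebra K L"
    and eq: "\<And>g. g \<in> G \<Longrightarrow> h (lie_cong K G R `` {Gen g}) = h' (lie_cong K G R `` {Gen g})"
  shows "h = h'"
proof -
  interpret lie_algebra K L by fact
  let ?P = "lie_presentation K G R"
  note ops = lie_presentation_ops[OF K, where G = G and R = R]
  have zero: "k (lie_cong K G R `` {Zero}) = \<zero>\<^bsub>L\<^esub>" if k: "k \<in> lie_hom K ?P L" for k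
  proof -
    interpret P: lie_algebra K ?P by (rule lie_algebra_presentation[OF K])
    have "k (\<zero>\<^bsub>?P\<^esub> \<oplus>\<^bsub>?P\<^esub> \<zero>\<^bsub>?P\<^esub>) = k \<zero>\<^bsub>?P\<^esub> \<oplus>\<^bsub>L\<^esub> k \<zero>\<^bsub>?P\<^esub>"
      using k by (simp add: lie_hom_def del: P.M.l_zero P.M.r_zero)
    moreover have "k \<zero>\<^bsub>?P\<^esub> \<in> carrier L" using k by (auto simp: lie_hom_def)
    ultimately have "k \<zero>\<^bsub>?P\<^esub> = \<zero>\<^bsub>L\<^esub>" by simp
    then show ?thesis by (simp add: ops)
  qed
  have "h (lie_cong K G R `` {t}) = h' (lie_cong K G R `` {t})" if "t \<in> lie_terms K G" for t
    using that
  proof induction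
    case Zero
    then show ?case using zero[OF h] zero[OF h'] by simp
  next
    case (Add s t)
    have step: "k (lie_cong K G R `` {Add s t}) = k (lie_cong K G R `` {s}) \<oplus>\<^bsub>L\<^esub> k (lie_cong K G R `` {t})"
      if "k \<in> lie_hom K ?P L" for k
      using that Add.hyps by (simp add: lie_hom_def ops flip: ops(1))
    show ?case using step[OF h] step[OF h'] Add.IH by simp
  next
    case (Scale c t)
    have step: "k (lie_cong K G R `` {Scale c t}) = c \<odot>\<^bsub>L\<^esub> k (lie_cong K G R `` {t})"
      if "k \<in> lie_hom K ?P L" for k
      using that Scale.hyps by (simp add: lie_hom_def ops flip: ops(3))
    show ?case using step[OF h] step[OF h'] Scale.IH by simp
  next
    case (Bracket s t)
    have step: "k (lie_cong K G R `` {Bracket s t}) = k (lie_cong K G R `` {s}) \<otimes>\<^bsub>L\<^esub> k (lie_cong K G R `` {t})"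
      if "k \<in> lie_hom K ?P L" for k
      using that Bracket.hyps by (simp add: lie_hom_def ops flip: ops(2))
    show ?case using step[OF h] step[OF h'] Bracket.IH by simp
  qed (rule eq)
  moreover have "h \<in> extensional (carrier ?P)" "h' \<in> extensional (carrier ?P)"
    using h h' by (auto simp: lie_hom_def PiE_def)
  ultimately show ?thesis
    by (intro extensionalityI[where A = "carrier ?P"]) (auto simp: ops)
qed

lemma hom_relations_value:
  assumes h: "h \<in> lie_hom K L N" and v: "\<And>x. x \<in> carrier L \<Longrightarrow> v (i x) = h x"
    and L: "lie_algebra K L" and st: "(s, t) \<in> hom_relations K L i"
  shows "term_value N v s = term_value N v t"
proof -
  interpret lie_algebra K L by fact
  show ?thesis
    using st h by (auto simp: hom_relations_def lie_hom_def v bracket_closed)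
qed

lemma hom_relations_hom:
  assumes L: "lie_algebra K L" and i: "i \<in> carrier L \<rightarrow> G" and R: "hom_relations K L i \<subseteq> R"
  shows "(\<lambda>x \<in> carrier L. lie_cong K G R `` {Gen (i x)}) \<in> lie_hom K L (lie_presentation K G R)"
proof -
  interpret lie_algebra K L by fact
  have K: "field K" ..
  note ops = lie_presentation_ops[OF K, where G = G and R = R]
  note eqI = equiv_class_eq[OF equiv_lie_cong[OF K, of G R]]
  have g: "Gen (i x) \<in> lie_terms K G" if "x \<in> carrier L" for x
    using that i by (auto intro: lie_terms.Gen)
  have "(Gen (i (x \<oplus>\<^bsub>L\<^esub> y)), Add (Gen (i x)) (Gen (i y))) \<in> lie_cong K G R"
    "(Gen (i (x \<otimes>\<^bsub>L\<^esub> y)), Bracket (Gen (i x)) (Gen (i y))) \<in> lie_cong K G R"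
    if "x \<in> carrier L" "y \<in> carrier L" for x y
    using that
    by (auto intro!: lie_cong.rel lie_terms.intros(3-) g bracket_closed subsetD[OF R])
      (auto simp: hom_relations_def)
  moreover have "(Gen (i (c \<odot>\<^bsub>L\<^esub> x)), Scale c (Gen (i x))) \<in> lie_cong K G R"
    if "c \<in> carrier K" "x \<in> carrier L" for c x
    using that
    by (auto intro!: lie_cong.rel lie_terms.intros(3-) g subsetD[OF R])
      (auto simp: hom_relations_def)
  ultimately show ?thesis
    unfolding lie_hom_def by (simp add: ops g bracket_closed eqI)
qed

lemma lie_hom_compose:
  assumes "f \<in> lie_hom K L M" "g \<in> lie_hom K M N" "lie_algebra K L"
  shows "compose (carrier L) g f \<in> lie_hom K L N"
proof -
  interpret lie_algebra K L by fact
  show ?thesis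
    using assms(1,2) by (auto simp: lie_hom_def compose_def bracket_closed PiE_iff Pi_iff)
qed

lemma lpoly_algebra_simps [simp]:
  "carrier (lpoly_algebra K A n) = carrier (free_lie_product K A (free_lie_algebra K {..<n}))"
  "add (lpoly_algebra K A n) = add (free_lie_product K A (free_lie_algebra K {..<n}))"
  "mult (lpoly_algebra K A n) = mult (free_lie_product K A (free_lie_algebra K {..<n}))"
  "smult (lpoly_algebra K A n) = smult (free_lie_product K A (free_lie_algebra K {..<n}))"
  "zero (lpoly_algebra K A n) = zero (free_lie_product K A (free_lie_algebra K {..<n}))"
  "emb (lpoly_algebra K A n) = free_product_inl K A (free_lie_algebra K {..<n})"
  by (simp_all add: lpoly_algebra_def module.defs alie.defs)

lemma lpoly_algebra_hom:
  "lie_hom K (lpoly_algebra K A n) B = lie_hom K (free_lie_product K A (free_lie_algebra K {..<n})) B"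
  "lie_hom K A (lpoly_algebra K A n) = lie_hom K A (free_lie_product K A (free_lie_algebra K {..<n}))"
  by (simp_all add: lie_hom_def)

lemma free_product_hom_exists:
  assumes L: "lie_algebra K L" and N: "lie_algebra K N" and M: "lie_algebra K M"
    and f: "f \<in> lie_hom K L M" and g: "g \<in> lie_hom K N M"
  obtains h where "h \<in> lie_hom K (free_lie_product K L N) M"
    and "\<And>x. x \<in> carrier L \<Longrightarrow> h (free_product_inl K L N x) = f x"
    and "\<And>y. y \<in> carrier N \<Longrightarrow> h (free_product_inr K L N y) = g y"
proof -
  have v: "case_sum f g \<in> free_product_gens L N \<rightarrow> carrier M"
    using f g by (auto simp: free_product_gens_def lie_hom_def)
  have R: "term_value M (case_sum f g) s = term_value M (case_sum f g) t"
    if "(s, t) \<in> free_product_rels K L N" for s t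
    using that hom_relations_value[OF f _ L, of "case_sum f g" Inl s t]
      hom_relations_value[OF g _ N, of "case_sum f g" Inr s t]
    by (auto simp: free_product_rels_def)
  obtain h where h: "h \<in> lie_hom K (free_lie_product K L N) M"
    "\<And>t. t \<in> lie_terms K (free_product_gens L N) \<Longrightarrow>
      h (lie_cong K (free_product_gens L N) (free_product_rels K L N) `` {t}) = term_value M (case_sum f g) t"
    using presentation_hom_exists[OF M v R] unfolding free_lie_product_def by blast
  show ?thesis
  proof (rule that[OF h(1)])
    show "h (free_product_inl K L N x) = f x" if "x \<in> carrier L" for x
      using that h(2)[of "Gen (Inl x)"]
      by (simp add: free_product_inl_def free_product_gens_def lie_terms.Gen InlI)
    show "h (free_product_inr K L N y) = g y" if "y \<in> carrier N" for y
      using that h(2)[of "Gen (Inr y)"]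
      by (simp add: free_product_inr_def free_product_gens_def lie_terms.Gen InrI)
  qed
qed

lemma free_product_hom_unique:
  assumes K: "field K" and M: "lie_algebra K M"
    and h: "h \<in> lie_hom K (free_lie_product K L N) M" and h': "h' \<in> lie_hom K (free_lie_product K L N) M"
    and "\<And>x. x \<in> carrier L \<Longrightarrow> h (free_product_inl K L N x) = h' (free_product_inl K L N x)"
    and "\<And>y. y \<in> carrier N \<Longrightarrow> h (free_product_inr K L N y) = h' (free_product_inr K L N y)"
  shows "h = h'"
proof (rule presentation_hom_unique[OF K h[unfolded free_lie_product_def] h'[unfolded free_lie_product_def] M])
  show "h (lie_cong K (free_product_gens L N) (free_product_rels K L N) `` {Gen g}) =
      h' (lie_cong K (free_product_gens L N) (free_product_rels K L N) `` {Gen g})"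
    if "g \<in> free_product_gens L N" for g
    using that[unfolded free_product_gens_def]
  proof (rule PlusE)
    fix x assume "x \<in> carrier L" "g = Inl x"
    then show ?thesis using assms(5)[of x] by (simp add: free_product_inl_def)
  next
    fix y assume "y \<in> carrier N" "g = Inr y"
    then show ?thesis using assms(6)[of y] by (simp add: free_product_inr_def)
  qed
qed

lemma free_product_injections:
  assumes "lie_algebra K L" "lie_algebra K N"
  shows "restrict (free_product_inl K L N) (carrier L) \<in> lie_hom K L (free_lie_product K L N)"
    and "restrict (free_product_inr K L N) (carrier N) \<in> lie_hom K N (free_lie_product K L N)"
  using hom_relations_hom[OF assms(1), of Inl "free_product_gens L N" "free_product_rels K L N"]
    hom_relations_hom[OF assms(2), of Inr "free_product_gens L N" "free_product_rels K L N"]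
  by (auto simp: free_lie_product_def free_product_inl_def[abs_def] free_product_inr_def[abs_def]
      free_product_gens_def free_product_rels_def)

lemma lie_algebra_free: "field K \<Longrightarrow> lie_algebra K (free_lie_algebra K X)"
  by (simp add: free_lie_algebra_def lie_algebra_presentation)

lemma lie_algebra_free_product: "field K \<Longrightarrow> lie_algebra K (free_lie_product K L N)"
  by (simp add: free_lie_product_def lie_algebra_presentation)

theorem A_lie_algebra_lpoly:
  assumes A: "lie_algebra K A"
  shows "A_lie_algebra K A (lpoly_algebra K A n)"
proof -
  interpret A: lie_algebra K A by fact
  have K: "field K" ..
  let ?F = "free_lie_algebra K {..<n}"
  interpret P: lie_algebra K "free_lie_product K A ?F" by (rule lie_algebra_free_product[OF K])
  have F: "lie_algebra K ?F" by (rule lie_algebra_free[OF K])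
  then interpret F: lie_algebra K ?F .
  have "lie_algebra K (lpoly_algebra K A n)"
  proof (intro lie_algebra.intro module.intro module_axioms.intro lie_algebra_axioms.intro K A.is_cring)
    show "abelian_group (lpoly_algebra K A n)"
    proof (rule abelian_groupI)
      show "\<exists>y \<in> carrier (lpoly_algebra K A n). y \<oplus>\<^bsub>lpoly_algebra K A n\<^esub> x = \<zero>\<^bsub>lpoly_algebra K A n\<^esub>"
        if "x \<in> carrier (lpoly_algebra K A n)" for x
        using that P.M.l_neg[of x] P.M.a_inv_closed[of x] by auto
    qed (simp_all add: P.M.a_assoc P.M.a_comm P.M.a_lcomm)
  qed (auto simp: P.smult_l_distr P.smult_r_distr P.smult_assoc1 P.bracket_closed
      P.bracket_add_left P.bracket_add_right P.bracket_smult_left P.bracket_smult_right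
      P.bracket_self P.jacobi)
  moreover obtain r where r: "\<And>a. a \<in> carrier A \<Longrightarrow> r (free_product_inl K A ?F a) = a"
  proof (rule free_product_hom_exists[OF A F A])
    show "restrict id (carrier A) \<in> lie_hom K A A"
      by (simp add: lie_hom_def A.bracket_closed)
    show "(\<lambda>y \<in> carrier ?F. \<zero>\<^bsub>A\<^esub>) \<in> lie_hom K ?F A"
      by (simp add: lie_hom_def F.bracket_closed A.bracket_self)
  qed auto
  then have "inj_on (free_product_inl K A ?F) (carrier A)"
    by (rule inj_on_inverseI)
  ultimately show ?thesis
    using A free_product_injections(1)[OF A F]
    by (simp add: A_lie_algebra_def lpoly_algebra_hom)
qed

theorem lpoly_eval_hom_unique:
  assumes B: "A_lie_algebra K A B" and p: "p \<in> affine_space B n"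
  shows "\<exists>!h. h \<in> A_hom K A (lpoly_algebra K A n) B \<and> (\<forall>i<n. h (lpoly_var K A n i) = p ! i)"
proof -
  have A: "lie_algebra K A" and L: "lie_algebra K B"
    and e: "restrict (emb B) (carrier A) \<in> lie_hom K A B"
    using B by (auto simp: A_lie_algebra_def)
  interpret B: lie_algebra K B by fact
  have K: "field K" ..
  let ?F = "free_lie_algebra K {..<n}"
  have F: "lie_algebra K ?F" by (rule lie_algebra_free[OF K])
  have v: "(!) p \<in> {..<n} \<rightarrow> carrier B"
    using p by (auto simp: affine_space_def)
  obtain g where g: "g \<in> lie_hom K ?F B"
    and gv: "\<And>t. t \<in> lie_terms K {..<n} \<Longrightarrow> g (lie_cong K {..<n} {} `` {t}) = term_value B ((!) p) t"
    using presentation_hom_exists[OF L v, of "{}"] unfolding free_lie_algebra_def by blast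
  have gen: "free_lie_gen K {..<n} i \<in> carrier ?F" if "i < n" for i
    using that
    by (auto simp: free_lie_algebra_def lie_presentation_ops[OF K] free_lie_gen_def intro!: lie_terms.Gen)
  have gx: "g (free_lie_gen K {..<n} i) = p ! i" if "i < n" for i
    using that gv[of "Gen i"] by (simp add: free_lie_gen_def lie_terms.Gen)
  show ?thesis
  proof (rule ex_ex1I)
    obtain h where "h \<in> lie_hom K (free_lie_product K A ?F) B"
      "\<And>a. a \<in> carrier A \<Longrightarrow> h (free_product_inl K A ?F a) = restrict (emb B) (carrier A) a"
      "\<And>y. y \<in> carrier ?F \<Longrightarrow> h (free_product_inr K A ?F y) = g y"
      using free_product_hom_exists[OF A F L e g] by blast
    then show "\<exists>h. h \<in> A_hom K A (lpoly_algebra K A n) B \<and> (\<forall>i<n. h (lpoly_var K A n i) = p ! i)"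
      by (intro exI[of _ h]) (simp add: A_hom_def lpoly_algebra_hom lpoly_var_def gen gx)
  next
    fix h h'
    assume h: "h \<in> A_hom K A (lpoly_algebra K A n) B \<and> (\<forall>i<n. h (lpoly_var K A n i) = p ! i)"
      and h': "h' \<in> A_hom K A (lpoly_algebra K A n) B \<and> (\<forall>i<n. h' (lpoly_var K A n i) = p ! i)"
    let ?inr = "restrict (free_product_inr K A ?F) (carrier ?F)"
    have hl: "h \<in> lie_hom K (free_lie_product K A ?F) B" "h' \<in> lie_hom K (free_lie_product K A ?F) B"
      using h h' by (auto simp: A_hom_def lpoly_algebra_hom)
    have "compose (carrier ?F) h ?inr = compose (carrier ?F) h' ?inr"
    proof (rule presentation_hom_unique[OF K _ _ L])
      show "compose (carrier ?F) h ?inr \<in> lie_hom K (lie_presentation K {..<n} {}) B"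
        "compose (carrier ?F) h' ?inr \<in> lie_hom K (lie_presentation K {..<n} {}) B"
        using lie_hom_compose[OF free_product_injections(2)[OF A F] _ F] hl
        by (simp_all flip: free_lie_algebra_def)
      fix i :: nat assume "i \<in> {..<n}"
      then show "compose (carrier ?F) h ?inr (lie_cong K {..<n} {} `` {Gen i}) =
          compose (carrier ?F) h' ?inr (lie_cong K {..<n} {} `` {Gen i})"
        using h h' gen[of i] by (simp add: compose_def lpoly_var_def flip: free_lie_gen_def)
    qed
    note eq = this
    have "h (free_product_inr K A ?F y) = h' (free_product_inr K A ?F y)" if "y \<in> carrier ?F" for y
      using fun_cong[OF eq, of y] that by (simp add: compose_def)
    then show "h = h'"
      using free_product_hom_unique[OF K L hl] h h' by (simp add: A_hom_def)
  qed
qed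

section \<open>Algebraic sets and coordinate algebras\<close>

definition zero_set ::
    "('k, 'm) ring_scheme \<Rightarrow> ('k, 'a, 'p) module_scheme \<Rightarrow> ('k, 'b, 'a, 'q) alie_scheme
      \<Rightarrow> nat \<Rightarrow> ('k, 'a) lpoly set \<Rightarrow> 'b list set"
  where "zero_set K A B n S = {p \<in> affine_space B n. \<forall>f \<in> S. lpoly_eval K A B n f p = \<zero>\<^bsub>B\<^esub>}"

text \<open>
  An algebraic set is recorded together with the dimension of its affine space, so that the empty
  subsets of different affine spaces are different objects.
\<close>

definition algebraic_sets ::
    "('k, 'm) ring_scheme \<Rightarrow> ('k, 'a, 'p) module_scheme \<Rightarrow> ('k, 'b, 'a, 'q) alie_scheme
      \<Rightarrow> (nat \<times> 'b list set) set"
  where "algebraic_sets K A B =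
    {(n, zero_set K A B n S) | n S. S \<subseteq> carrier (lpoly_algebra K A n)}"

definition Rad ::
    "('k, 'm) ring_scheme \<Rightarrow> ('k, 'a, 'p) module_scheme \<Rightarrow> ('k, 'b, 'a, 'q) alie_scheme
      \<Rightarrow> nat \<Rightarrow> 'b list set \<Rightarrow> ('k, 'a) lpoly set"
  where "Rad K A B n Y =
    {f \<in> carrier (lpoly_algebra K A n). \<forall>p \<in> Y. lpoly_eval K A B n f p = \<zero>\<^bsub>B\<^esub>}"

definition alie_quotient :: "('k, 'c, 'a) alie \<Rightarrow> 'c set \<Rightarrow> ('k, 'c set, 'a) alie"
  where "alie_quotient C I =
    \<lparr>carrier = a_rcosets\<^bsub>C\<^esub> I,
     mult = rcoset_mult C I,
     one = I,
     zero = I,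
     add = set_add C,
     smult = (\<lambda>c U. \<Union>x\<in>U. I +>\<^bsub>C\<^esub> (c \<odot>\<^bsub>C\<^esub> x)),
     emb = (\<lambda>a. I +>\<^bsub>C\<^esub> emb C a)\<rparr>"

definition coordinate_algebra ::
    "('k, 'm) ring_scheme \<Rightarrow> ('k, 'a, 'p) module_scheme \<Rightarrow> ('k, 'b, 'a, 'q) alie_scheme
      \<Rightarrow> nat \<times> 'b list set \<Rightarrow> ('k, ('k, 'a) lpoly set, 'a) alie"
  where "coordinate_algebra K A B Y =
    alie_quotient (lpoly_algebra K A (fst Y)) (Rad K A B (fst Y) (snd Y))"

section \<open>Categories and equivalence\<close>

text \<open>
  Hom-sets need not be disjoint, so identities and composition take the objects as arguments:
  \<open>Comp C X Y Z g f\<close> is \<open>g\<close> after \<open>f\<close> for \<open>f : X \<rightarrow> Y\<close> and \<open>g : Y \<rightarrow> Z\<close>.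
\<close>

record ('o, 'm) cat =
  Ob :: "'o set"
  Hom :: "'o \<Rightarrow> 'o \<Rightarrow> 'm set"
  Id :: "'o \<Rightarrow> 'm"
  Comp :: "'o \<Rightarrow> 'o \<Rightarrow> 'o \<Rightarrow> 'm \<Rightarrow> 'm \<Rightarrow> 'm"

locale category =
  fixes C :: "('o, 'm) cat"
  assumes Id_in_Hom: "X \<in> Ob C \<Longrightarrow> Id C X \<in> Hom C X X"
    and Comp_in_Hom:
      "\<lbrakk>X \<in> Ob C; Y \<in> Ob C; Z \<in> Ob C; f \<in> Hom C X Y; g \<in> Hom C Y Z\<rbrakk>
        \<Longrightarrow> Comp C X Y Z g f \<in> Hom C X Z"
    and Comp_Id_right:
      "\<lbrakk>X \<in> Ob C; Y \<in> Ob C; f \<in> Hom C X Y\<rbrakk> \<Longrightarrow> Comp C X X Y f (Id C X) = f"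
    and Comp_Id_left:
      "\<lbrakk>X \<in> Ob C; Y \<in> Ob C; f \<in> Hom C X Y\<rbrakk> \<Longrightarrow> Comp C X Y Y (Id C Y) f = f"
    and Comp_assoc:
      "\<lbrakk>W \<in> Ob C; X \<in> Ob C; Y \<in> Ob C; Z \<in> Ob C;
        f \<in> Hom C W X; g \<in> Hom C X Y; h \<in> Hom C Y Z\<rbrakk>
        \<Longrightarrow> Comp C W Y Z h (Comp C W X Y g f) = Comp C W X Z (Comp C X Y Z h g) f"

definition op_cat :: "('o, 'm) cat \<Rightarrow> ('o, 'm) cat"
  where "op_cat C =
    \<lparr>Ob = Ob C, Hom = (\<lambda>X Y. Hom C Y X), Id = Id C, Comp = (\<lambda>X Y Z g f. Comp C Z Y X f g)\<rparr>"

locale cat_functor = source: category C + target: category D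
  for C :: "('o, 'm) cat" and D :: "('p, 'n) cat" +
  fixes Fo :: "'o \<Rightarrow> 'p" and Fm :: "'o \<Rightarrow> 'o \<Rightarrow> 'm \<Rightarrow> 'n"
  assumes Fo_in_Ob: "X \<in> Ob C \<Longrightarrow> Fo X \<in> Ob D"
    and Fm_in_Hom:
      "\<lbrakk>X \<in> Ob C; Y \<in> Ob C; f \<in> Hom C X Y\<rbrakk> \<Longrightarrow> Fm X Y f \<in> Hom D (Fo X) (Fo Y)"
    and Fm_Id: "X \<in> Ob C \<Longrightarrow> Fm X X (Id C X) = Id D (Fo X)"
    and Fm_Comp:
      "\<lbrakk>X \<in> Ob C; Y \<in> Ob C; Z \<in> Ob C; f \<in> Hom C X Y; g \<in> Hom C Y Z\<rbrakk>
        \<Longrightarrow> Fm X Z (Comp C X Y Z g f) = Comp D (Fo X) (Fo Y) (Fo Z) (Fm Y Z g) (Fm X Y f)"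

definition cat_iso :: "('o, 'm) cat \<Rightarrow> 'o \<Rightarrow> 'o \<Rightarrow> 'm \<Rightarrow> bool"
  where "cat_iso C X Y f \<longleftrightarrow>
    f \<in> Hom C X Y \<and>
    (\<exists>g \<in> Hom C Y X. Comp C X Y X g f = Id C X \<and> Comp C Y X Y f g = Id C Y)"

definition nat_iso ::
    "('o, 'm) cat \<Rightarrow> ('p, 'n) cat \<Rightarrow> ('o \<Rightarrow> 'p) \<Rightarrow> ('o \<Rightarrow> 'o \<Rightarrow> 'm \<Rightarrow> 'n)
      \<Rightarrow> ('o \<Rightarrow> 'p) \<Rightarrow> ('o \<Rightarrow> 'o \<Rightarrow> 'm \<Rightarrow> 'n) \<Rightarrow> ('o \<Rightarrow> 'n) \<Rightarrow> bool"
  where "nat_iso C D Fo Fm Go Gm \<eta> \<longleftrightarrow>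
    (\<forall>X \<in> Ob C. cat_iso D (Fo X) (Go X) (\<eta> X)) \<and>
    (\<forall>X \<in> Ob C. \<forall>Y \<in> Ob C. \<forall>f \<in> Hom C X Y.
      Comp D (Fo X) (Fo Y) (Go Y) (\<eta> Y) (Fm X Y f) = Comp D (Fo X) (Go X) (Go Y) (Gm X Y f) (\<eta> X))"

definition equivalent_cats :: "('o, 'm) cat \<Rightarrow> ('p, 'n) cat \<Rightarrow> bool"
  where "equivalent_cats C D \<longleftrightarrow>
    (\<exists>Fo Fm Go Gm \<eta> \<epsilon>.
      cat_functor C D Fo Fm \<and> cat_functor D C Go Gm \<and>
      nat_iso C C (\<lambda>X. X) (\<lambda>X Y f. f) (\<lambda>X. Go (Fo X)) (\<lambda>X Y f. Gm (Fo X) (Fo Y) (Fm X Y f)) \<eta> \<and>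
      nat_iso D D (\<lambda>X. Fo (Go X)) (\<lambda>X Y f. Fm (Go X) (Go Y) (Gm X Y f)) (\<lambda>X. X) (\<lambda>X Y f. f) \<epsilon>)"

text \<open>A contravariant functor on \<open>C\<close> is a functor on the opposite category.\<close>

definition contravariantly_equivalent :: "('o, 'm) cat \<Rightarrow> ('p, 'n) cat \<Rightarrow> bool"
  where "contravariantly_equivalent C D \<longleftrightarrow> equivalent_cats (op_cat C) D"

section \<open>The categories of algebraic sets and of coordinate algebras\<close>

text \<open>
  The condition \<open>snd Y = {} \<longrightarrow> snd Z = {}\<close> excludes the empty map from the empty set to a nonempty
  algebraic set. It is the counterpart of the convention \<open>Hom\<^sub>A(\<Gamma>, 0) = \<emptyset>\<close> below: with the empty map
  admitted and that convention kept, the empty algebraic set would have a morphism to every object while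
  its coordinate algebra is joined to no nonempty set's, so the two categories could not be equivalent
  whenever \<open>A \<noteq> 0\<close>.
\<close>

definition AS_hom ::
    "('k, 'm) ring_scheme \<Rightarrow> ('k, 'a, 'p) module_scheme \<Rightarrow> ('k, 'b, 'a, 'q) alie_scheme
      \<Rightarrow> nat \<times> 'b list set \<Rightarrow> nat \<times> 'b list set \<Rightarrow> ('b list \<Rightarrow> 'b list) set"
  where "AS_hom K A B Y Z =
    {\<psi> \<in> snd Y \<rightarrow>\<^sub>E snd Z.
      (snd Y = {} \<longrightarrow> snd Z = {}) \<and>
      (\<exists>fs. length fs = fst Z \<and> set fs \<subseteq> carrier (lpoly_algebra K A (fst Y)) \<and>
        (\<forall>p \<in> snd Y. \<psi> p = map (\<lambda>f. lpoly_eval K A B (fst Y) f p) fs))}"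

definition AS ::
    "('k, 'm) ring_scheme \<Rightarrow> ('k, 'a, 'p) module_scheme \<Rightarrow> ('k, 'b, 'a, 'q) alie_scheme
      \<Rightarrow> (nat \<times> 'b list set, 'b list \<Rightarrow> 'b list) cat"
  where "AS K A B =
    \<lparr>Ob = algebraic_sets K A B,
     Hom = AS_hom K A B,
     Id = (\<lambda>Y. restrict id (snd Y)),
     Comp = (\<lambda>X Y Z g f. compose (snd X) g f)\<rparr>"

definition empty_coordinate_algebras ::
    "('k, 'm) ring_scheme \<Rightarrow> ('k, 'a, 'p) module_scheme \<Rightarrow> ('k, 'b, 'a, 'q) alie_scheme
      \<Rightarrow> ('k, ('k, 'a) lpoly set, 'a) alie set"
  where "empty_coordinate_algebras K A B =
    coordinate_algebra K A B ` {Y \<in> algebraic_sets K A B. snd Y = {}}"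

text \<open>
  By convention there are no morphisms, in either direction, between the zero coordinate algebra of the
  empty set and the coordinate algebra of a nonempty set.
\<close>

definition CA_hom ::
    "('k, 'm) ring_scheme \<Rightarrow> ('k, 'a, 'p) module_scheme \<Rightarrow> ('k, 'b, 'a, 'q) alie_scheme
      \<Rightarrow> ('k, ('k, 'a) lpoly set, 'a) alie \<Rightarrow> ('k, ('k, 'a) lpoly set, 'a) alie
      \<Rightarrow> (('k, 'a) lpoly set \<Rightarrow> ('k, 'a) lpoly set) set"
  where "CA_hom K A B C D =
    (if C \<in> empty_coordinate_algebras K A B \<longleftrightarrow> D \<in> empty_coordinate_algebras K A B
     then A_hom K A C D else {})"

definition CA ::
    "('k, 'm) ring_scheme \<Rightarrow> ('k, 'a, 'p) module_scheme \<Rightarrow> ('k, 'b, 'a, 'q) alie_scheme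
      \<Rightarrow> (('k, ('k, 'a) lpoly set, 'a) alie, ('k, 'a) lpoly set \<Rightarrow> ('k, 'a) lpoly set) cat"
  where "CA K A B =
    \<lparr>Ob = coordinate_algebra K A B ` algebraic_sets K A B,
     Hom = CA_hom K A B,
     Id = (\<lambda>C. restrict id (carrier C)),
     Comp = (\<lambda>X Y Z g f. compose (carrier X) g f)\<rparr>"

end

theory Submission
  imports Defs
begin

text \<open>
  The coset \<open>f + Rad(Y)\<close> consists of the polynomials that agree with \<open>f\<close> on \<open>Y\<close>, so \<open>\<Gamma>(Y)\<close> is the
  algebra of polynomial functions on \<open>Y\<close>, and a morphism \<open>\<psi> : Y \<rightarrow> Z\<close> induces \<open>\<Gamma>(Z) \<rightarrow> \<Gamma>(Y)\<close> by
  precomposition. This functor is surjective on objects. It is faithful because the coordinates of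
  \<open>\<psi>\<close> are the pullbacks of the variables, and full because the images of the variables under a given
  homomorphism \<open>h\<close> are the coordinates of a map on \<open>Y\<close>. That map takes its values in \<open>Z\<close> since \<open>h\<close> kills
  the classes of the equations of \<open>Z\<close>. The conventions for the empty set match because its
  coordinate algebra is never that of a nonempty algebraic set.
\<close>

section \<open>Categories\<close>

lemma category_op_cat:
  assumes "category C"
  shows "category (op_cat C)"
proof -
  interpret category C by fact
  show ?thesis
    by unfold_locales
      (auto simp: op_cat_def Id_in_Hom Comp_in_Hom Comp_Id_left Comp_Id_right Comp_assoc)
qed

text \<open>A fully faithful functor that is surjective on objects has a quasi-inverse:
  \<open>G\<close> picks a preimage of each object, and full faithfulness lifts morphisms uniquely.
  Every equation needed in \<open>C\<close> is checked after applying \<open>Fm\<close>, which is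
  injective on hom-sets.\<close>

lemma (in cat_functor) equivalent_cats_if_bij:
  assumes ob: "Fo ` Ob C = Ob D"
    and bij: "\<And>X Y. \<lbrakk>X \<in> Ob C; Y \<in> Ob C\<rbrakk> \<Longrightarrow> bij_betw (Fm X Y) (Hom C X Y) (Hom D (Fo X) (Fo Y))"
  shows "equivalent_cats C D"
proof -
  define G where "G = inv_into (Ob C) Fo"
  define L where "L X Y = inv_into (Hom C X Y) (Fm X Y)" for X Y
  have G [simp]: "Fo (G Z) = Z" "G Z \<in> Ob C" if "Z \<in> Ob D" for Z
    using that unfolding G_def ob[symmetric] by (auto intro: f_inv_into_f inv_into_into)
  have L [simp]: "L X Y g \<in> Hom C X Y" "Fm X Y (L X Y g) = g"
    if "X \<in> Ob C" "Y \<in> Ob C" "g \<in> Hom D (Fo X) (Fo Y)" for X Y g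
    using bij[OF that(1,2)] that(3) unfolding L_def bij_betw_def
    by (auto intro: f_inv_into_f inv_into_into)
  have inj: "f = g"
    if "X \<in> Ob C" "Y \<in> Ob C" "f \<in> Hom C X Y" "g \<in> Hom C X Y" "Fm X Y f = Fm X Y g" for X Y f g
    using bij[OF that(1,2)] that(3-) by (auto simp: bij_betw_def inj_on_def)
  define Gm where "Gm X Y = L (G X) (G Y)" for X Y
  have Gm [simp]: "Gm X Y g \<in> Hom C (G X) (G Y)" "Fm (G X) (G Y) (Gm X Y g) = g"
    if "X \<in> Ob D" "Y \<in> Ob D" "g \<in> Hom D X Y" for X Y g
    using that by (simp_all add: Gm_def)
  have Gfun: "cat_functor D C G Gm"
  proof unfold_locales
    fix X assume X: "X \<in> Ob D"
    show "Gm X X (Id D X) = Id C (G X)"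
      by (rule inj[where X = "G X" and Y = "G X"]) (use X in \<open>simp_all add: source.Id_in_Hom target.Id_in_Hom Fm_Id\<close>)
  next
    fix X Y Z f g
    assume *: "X \<in> Ob D" "Y \<in> Ob D" "Z \<in> Ob D" "f \<in> Hom D X Y" "g \<in> Hom D Y Z"
    have m: "Gm X Y f \<in> Hom C (G X) (G Y)" "Gm Y Z g \<in> Hom C (G Y) (G Z)"
      "Comp D X Y Z g f \<in> Hom D X Z"
      using * by (simp_all add: target.Comp_in_Hom[of X Y Z])
    show "Gm X Z (Comp D X Y Z g f) = Comp C (G X) (G Y) (G Z) (Gm Y Z g) (Gm X Y f)"
      by (rule inj[where X = "G X" and Y = "G Z"])
        (use * m in \<open>simp_all add: source.Comp_in_Hom[of "G X" "G Y" "G Z"]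
          Fm_Comp[of "G X" "G Y" "G Z"]\<close>)
  qed simp_all
  \<comment> \<open>Since \<open>Fo (G (Fo X)) = Fo X\<close>, the identity of \<open>Fo X\<close>
    lifts to morphisms in both directions between \<open>X\<close> and \<open>G (Fo X)\<close>. Both
    composites map to an identity under \<open>Fm\<close>, so the two lifts are mutually
    inverse.\<close>
  define \<eta> where "\<eta> X = L X (G (Fo X)) (Id D (Fo X))" for X
  define \<theta> where "\<theta> X = L (G (Fo X)) X (Id D (Fo X))" for X
  have \<eta>: "\<eta> X \<in> Hom C X (G (Fo X))" "Fm X (G (Fo X)) (\<eta> X) = Id D (Fo X)"
    and \<theta>: "\<theta> X \<in> Hom C (G (Fo X)) X" "Fm (G (Fo X)) X (\<theta> X) = Id D (Fo X)"
    if "X \<in> Ob C" for X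
    using that by (simp_all add: \<eta>_def \<theta>_def target.Id_in_Hom Fo_in_Ob)
  have iso: "cat_iso C X (G (Fo X)) (\<eta> X)" if X: "X \<in> Ob C" for X
    unfolding cat_iso_def
  proof (intro conjI bexI)
    have ob: "Fo X \<in> Ob D" "G (Fo X) \<in> Ob C" using X by (simp_all add: Fo_in_Ob)
    note * = X ob \<eta>[OF X] \<theta>[OF X]
    show "Comp C X (G (Fo X)) X (\<theta> X) (\<eta> X) = Id C X"
      by (rule inj[where X = X and Y = X])
        (use * in \<open>simp_all add: source.Comp_in_Hom[of X "G (Fo X)" X] Fm_Comp[of X "G (Fo X)" X]
          source.Id_in_Hom target.Id_in_Hom Fm_Id target.Comp_Id_left\<close>)
    show "Comp C (G (Fo X)) X (G (Fo X)) (\<eta> X) (\<theta> X) = Id C (G (Fo X))"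
      by (rule inj[where X = "G (Fo X)" and Y = "G (Fo X)"])
        (use * in \<open>simp_all add: source.Comp_in_Hom[of "G (Fo X)" X "G (Fo X)"]
          Fm_Comp[of "G (Fo X)" X "G (Fo X)"]
          source.Id_in_Hom target.Id_in_Hom Fm_Id target.Comp_Id_left\<close>)
  qed (use \<eta> \<theta> X in auto)
  have nat: "Comp C X Y (G (Fo Y)) (\<eta> Y) f =
      Comp C X (G (Fo X)) (G (Fo Y)) (Gm (Fo X) (Fo Y) (Fm X Y f)) (\<eta> X)"
    if X: "X \<in> Ob C" and Y: "Y \<in> Ob C" and f: "f \<in> Hom C X Y" for X Y f
  proof -
    have ob: "Fo X \<in> Ob D" "G (Fo X) \<in> Ob C" "Fo Y \<in> Ob D" "G (Fo Y) \<in> Ob C"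
      using X Y by (simp_all add: Fo_in_Ob)
    have Ff: "Fm X Y f \<in> Hom D (Fo X) (Fo Y)" using X Y f by (rule Fm_in_Hom)
    note * = X Y f ob Ff \<eta>[OF X] \<eta>[OF Y] Gm[OF ob(1,3) Ff]
    show ?thesis
      by (rule inj[where X = X and Y = "G (Fo Y)"])
        (use * in \<open>simp_all add: source.Comp_in_Hom[of X Y "G (Fo Y)"]
          source.Comp_in_Hom[of X "G (Fo X)" "G (Fo Y)"] Fm_Comp[of X Y "G (Fo Y)"]
          Fm_Comp[of X "G (Fo X)" "G (Fo Y)"] target.Comp_Id_left target.Comp_Id_right\<close>)
  qed
  show ?thesis
    unfolding equivalent_cats_def nat_iso_def
  proof (intro exI conjI)
    show "cat_functor C D Fo Fm" by unfold_locales
    show "cat_functor D C G Gm" by (rule Gfun)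
    show "\<forall>X\<in>Ob C. cat_iso C X (G (Fo X)) (\<eta> X)" using iso by blast
    show "\<forall>X\<in>Ob C. \<forall>Y\<in>Ob C. \<forall>f\<in>Hom C X Y. Comp C X Y (G (Fo Y)) (\<eta> Y) f =
        Comp C X (G (Fo X)) (G (Fo Y)) (Gm (Fo X) (Fo Y) (Fm X Y f)) (\<eta> X)"
      using nat by blast
    \<comment> \<open>\<open>G\<close> is a strict section of \<open>Fo\<close>, on objects and on
      morphisms, so identities serve as the counit.\<close>
    show "\<forall>X\<in>Ob D. cat_iso D (Fo (G X)) X (Id D X)"
      by (auto simp: cat_iso_def target.Id_in_Hom target.Comp_Id_left intro!: bexI[of _ "Id D _"])
    show "\<forall>X\<in>Ob D. \<forall>Y\<in>Ob D. \<forall>f\<in>Hom D X Y.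
        Comp D (Fo (G X)) (Fo (G Y)) Y (Id D Y) (Fm (G X) (G Y) (Gm X Y f)) =
        Comp D (Fo (G X)) X Y f (Id D X)"
      by (simp add: target.Comp_Id_left target.Comp_Id_right)
  qed
qed

section \<open>Evaluation\<close>

text \<open>From here on, apart from the closure of the variables, \<open>A[X]\<close> is handled
  through its universal property and the Lie algebra axioms, not through its construction as a free
  product.\<close>

declare lpoly_algebra_simps [simp del]

text \<open>The target \<open>B\<close> is an arbitrary \<open>A\<close>-Lie algebra here. It can be
  a polynomial algebra itself, and evaluation is then substitution of polynomials.\<close>

lemma lpoly_eval_hom_A_hom:
  assumes "A_lie_algebra K A B" "p \<in> affine_space B n"
  shows "lpoly_eval_hom K A B n p \<in> A_hom K A (lpoly_algebra K A n) B"
  using theI'[OF lpoly_eval_hom_unique[OF assms]] by (simp add: lpoly_eval_hom_def)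

lemma lpoly_eval_var:
  assumes "A_lie_algebra K A B" "p \<in> affine_space B n" "i < n"
  shows "lpoly_eval K A B n (lpoly_var K A n i) p = p ! i"
  using theI'[OF lpoly_eval_hom_unique[OF assms(1,2)]] assms(3)
  by (simp add: lpoly_eval_hom_def lpoly_eval_def)

text \<open>The uniqueness half of the universal property. It serves to identify evaluation with a
  map built by other means, once that map is known to be an \<open>A\<close>-homomorphism with the
  right values at the variables.\<close>

lemma lpoly_eval_eqI:
  assumes B: "A_lie_algebra K A B" and p: "p \<in> affine_space B n"
    and h: "h \<in> A_hom K A (lpoly_algebra K A n) B" "\<And>i. i < n \<Longrightarrow> h (lpoly_var K A n i) = p ! i"
  shows "lpoly_eval K A B n f p = h f"
proof -
  have "lpoly_eval_hom K A B n p = h"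
    unfolding lpoly_eval_hom_def
    by (rule the1_equality[OF lpoly_eval_hom_unique[OF B p]]) (use h in blast)
  then show ?thesis by (simp add: lpoly_eval_def)
qed

lemma lpoly_eval_morphism:
  assumes "A_lie_algebra K A B" "p \<in> affine_space B n"
  shows lpoly_eval_closed: "f \<in> carrier (lpoly_algebra K A n) \<Longrightarrow> lpoly_eval K A B n f p \<in> carrier B"
    and lpoly_eval_add: "\<lbrakk>f \<in> carrier (lpoly_algebra K A n); g \<in> carrier (lpoly_algebra K A n)\<rbrakk> \<Longrightarrow>
      lpoly_eval K A B n (f \<oplus>\<^bsub>lpoly_algebra K A n\<^esub> g) p = lpoly_eval K A B n f p \<oplus>\<^bsub>B\<^esub> lpoly_eval K A B n g p"
    and lpoly_eval_bracket: "\<lbrakk>f \<in> carrier (lpoly_algebra K A n); g \<in> carrier (lpoly_algebra K A n)\<rbrakk> \<Longrightarrow>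
      lpoly_eval K A B n (f \<otimes>\<^bsub>lpoly_algebra K A n\<^esub> g) p = lpoly_eval K A B n f p \<otimes>\<^bsub>B\<^esub> lpoly_eval K A B n g p"
    and lpoly_eval_smult: "\<lbrakk>c \<in> carrier K; f \<in> carrier (lpoly_algebra K A n)\<rbrakk> \<Longrightarrow>
      lpoly_eval K A B n (c \<odot>\<^bsub>lpoly_algebra K A n\<^esub> f) p = c \<odot>\<^bsub>B\<^esub> lpoly_eval K A B n f p"
    and lpoly_eval_emb: "a \<in> carrier A \<Longrightarrow> lpoly_eval K A B n (emb (lpoly_algebra K A n) a) p = emb B a"
  using lpoly_eval_hom_A_hom[OF assms] by (auto simp: A_hom_def lie_hom_def lpoly_eval_def)

lemma lpoly_var_closed:
  assumes "field K" "lie_algebra K A" "i < n"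
  shows "lpoly_var K A n i \<in> carrier (lpoly_algebra K A n)"
proof -
  note F = lie_algebra_free[OF assms(1), of "{..<n}"]
  have "free_lie_gen K {..<n} i \<in> carrier (free_lie_algebra K {..<n})"
    using assms(3)
    by (auto simp: free_lie_algebra_def lie_presentation_ops[OF assms(1)] free_lie_gen_def
        intro!: lie_terms.Gen)
  then show ?thesis
    using free_product_injections(2)[OF assms(2) F]
    by (auto simp: lie_hom_def lpoly_algebra_simps lpoly_var_def)
qed

section \<open>Evaluation over a fixed \<open>A\<close>-Lie algebra, and substitution\<close>

locale A_lie =
  fixes K :: "('k, 'm) ring_scheme"
    and A :: "('k, 'a, 'p) module_scheme"
    and B :: "('k, 'b, 'a, 'q) alie_scheme"
  assumes B: "A_lie_algebra K A B"
begin

abbreviation "P \<equiv> lpoly_algebra K A"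
abbreviation "eval \<equiv> lpoly_eval K A B"

lemma A: "lie_algebra K A" and LB: "lie_algebra K B"
  using B by (auto simp: A_lie_algebra_def)

lemma field_K: "field K"
proof -
  interpret lie_algebra K A by (rule A)
  show ?thesis ..
qed

lemma P_A_lie: "A_lie_algebra K A (P n)"
  by (rule A_lie_algebra_lpoly[OF A])

lemma P_lie: "lie_algebra K (P n)"
  using P_A_lie by (auto simp: A_lie_algebra_def)

lemmas var_closed = lpoly_var_closed[OF field_K A]
lemmas eval_morphism = lpoly_eval_morphism[OF B]
lemmas eval_var = lpoly_eval_var[OF B]

lemma emb_closed: "a \<in> carrier A \<Longrightarrow> emb (P n) a \<in> carrier (P n)"
  using P_A_lie[of n] by (auto simp: A_lie_algebra_def lie_hom_def PiE_iff)

lemma P_closed: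
  "f \<in> carrier (P n) \<Longrightarrow> g \<in> carrier (P n) \<Longrightarrow> f \<oplus>\<^bsub>P n\<^esub> g \<in> carrier (P n)"
  "f \<in> carrier (P n) \<Longrightarrow> g \<in> carrier (P n) \<Longrightarrow> f \<otimes>\<^bsub>P n\<^esub> g \<in> carrier (P n)"
  "c \<in> carrier K \<Longrightarrow> f \<in> carrier (P n) \<Longrightarrow> c \<odot>\<^bsub>P n\<^esub> f \<in> carrier (P n)"
  "\<zero>\<^bsub>P n\<^esub> \<in> carrier (P n)"
proof -
  interpret P: lie_algebra K "P n" by (rule P_lie)
  show "f \<in> carrier (P n) \<Longrightarrow> g \<in> carrier (P n) \<Longrightarrow> f \<oplus>\<^bsub>P n\<^esub> g \<in> carrier (P n)"
    "f \<in> carrier (P n) \<Longrightarrow> g \<in> carrier (P n) \<Longrightarrow> f \<otimes>\<^bsub>P n\<^esub> g \<in> carrier (P n)"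
    "c \<in> carrier K \<Longrightarrow> f \<in> carrier (P n) \<Longrightarrow> c \<odot>\<^bsub>P n\<^esub> f \<in> carrier (P n)"
    "\<zero>\<^bsub>P n\<^esub> \<in> carrier (P n)"
    by (simp_all add: P.bracket_closed)
qed

text \<open>\<open>lie_hom\<close> does not demand that zero be preserved. Additivity yields it: the
  value \<open>v\<close> at zero satisfies \<open>v + v = v\<close>.\<close>

lemma eval_zero:
  assumes p: "p \<in> affine_space B n"
  shows "eval n \<zero>\<^bsub>P n\<^esub> p = \<zero>\<^bsub>B\<^esub>"
proof -
  interpret P: lie_algebra K "P n" by (rule P_lie)
  interpret B: lie_algebra K B by (rule LB)
  have "eval n \<zero>\<^bsub>P n\<^esub> p \<oplus>\<^bsub>B\<^esub> eval n \<zero>\<^bsub>P n\<^esub> p = eval n \<zero>\<^bsub>P n\<^esub> p"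
    using eval_morphism(2)[OF p, of "\<zero>\<^bsub>P n\<^esub>" "\<zero>\<^bsub>P n\<^esub>"] by simp
  then show ?thesis using eval_morphism(1)[OF p, of "\<zero>\<^bsub>P n\<^esub>"] by simp
qed

text \<open>As functions of \<open>g\<close>, both sides are \<open>A\<close>-homomorphisms into
  \<open>B\<close> with the same values at the variables. The right one is the composite
  \<open>?h\<close>: substitute \<open>fs\<close> for the variables, then evaluate at
  \<open>p\<close>.\<close>

lemma eval_subst:
  assumes p: "p \<in> affine_space B n" and fs: "set fs \<subseteq> carrier (P n)" and g: "g \<in> carrier (P (length fs))"
  shows "eval (length fs) g (map (\<lambda>f. eval n f p) fs) =
    eval n (lpoly_eval K A (P n) (length fs) g fs) p"
proof -
  let ?m = "length fs"
  let ?h = "compose (carrier (P ?m)) (lpoly_eval_hom K A B n p) (lpoly_eval_hom K A (P n) ?m fs)"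
  have fs': "fs \<in> affine_space (P n) ?m" using fs by (simp add: affine_space_def)
  have q: "map (\<lambda>f. eval n f p) fs \<in> affine_space B ?m"
    using fs eval_morphism(1)[OF p] by (auto simp: affine_space_def)
  note h1 = lpoly_eval_hom_A_hom[OF P_A_lie fs'] and h2 = lpoly_eval_hom_A_hom[OF B p]
  have "?h \<in> A_hom K A (P ?m) B"
    using h1 h2 lie_hom_compose[OF _ _ P_lie]
    by (auto simp: A_hom_def compose_eq emb_closed)
  moreover have "?h (lpoly_var K A ?m i) = map (\<lambda>f. eval n f p) fs ! i" if "i < ?m" for i
    using lpoly_eval_var[OF P_A_lie fs' that] that
    by (simp add: compose_eq var_closed lpoly_eval_def)
  ultimately have "eval ?m g (map (\<lambda>f. eval n f p) fs) = ?h g"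
    by (intro lpoly_eval_eqI[OF B q]) auto
  then show ?thesis using g by (simp add: compose_eq lpoly_eval_def)
qed

section \<open>Coordinate algebras as algebras of polynomial functions\<close>

text \<open>This is the coset \<open>f + Rad(Y)\<close> described by values alone, so that equality
  of classes is equality of functions on \<open>Y\<close>. For empty \<open>Y\<close> the only class
  is the whole carrier.\<close>

definition fun_class :: "nat \<Rightarrow> 'b list set \<Rightarrow> ('k, 'a) lpoly \<Rightarrow> ('k, 'a) lpoly set"
  where "fun_class n Y f = {g \<in> carrier (P n). \<forall>p\<in>Y. eval n g p = eval n f p}"

lemma P_diff:
  assumes "f \<in> carrier (P n)" "g \<in> carrier (P n)"
  obtains d where "d \<in> carrier (P n)" "d \<oplus>\<^bsub>P n\<^esub> g = f"
proof
  interpret P: lie_algebra K "P n" by (rule P_lie)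
  show "f \<ominus>\<^bsub>P n\<^esub> g \<in> carrier (P n)" "(f \<ominus>\<^bsub>P n\<^esub> g) \<oplus>\<^bsub>P n\<^esub> g = f"
    using assms by (simp_all add: P.M.minus_eq P.M.a_assoc P.M.l_neg)
qed

lemma fun_class_self: "f \<in> carrier (P n) \<Longrightarrow> f \<in> fun_class n Y f"
  by (simp add: fun_class_def)

lemma fun_class_eq_iff:
  assumes "f \<in> carrier (P n)" "g \<in> carrier (P n)"
  shows "fun_class n Y f = fun_class n Y g \<longleftrightarrow> (\<forall>p\<in>Y. eval n f p = eval n g p)"
  using assms by (auto simp: fun_class_def)

lemma Rad_eq_fun_class:
  assumes "Y \<subseteq> affine_space B n"
  shows "Rad K A B n Y = fun_class n Y \<zero>\<^bsub>P n\<^esub>"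
  using assms by (auto simp: Rad_def fun_class_def eval_zero subset_iff)

lemma fun_class_set_add:
  assumes Y: "Y \<subseteq> affine_space B n" and f: "f \<in> carrier (P n)" and g: "g \<in> carrier (P n)"
  shows "fun_class n Y f <+>\<^bsub>P n\<^esub> fun_class n Y g = fun_class n Y (f \<oplus>\<^bsub>P n\<^esub> g)"
proof (intro equalityI subsetI)
  fix u assume "u \<in> fun_class n Y f <+>\<^bsub>P n\<^esub> fun_class n Y g"
  then show "u \<in> fun_class n Y (f \<oplus>\<^bsub>P n\<^esub> g)"
    using Y f g by (auto simp: set_add_def' fun_class_def P_closed eval_morphism subset_iff)
next
  interpret B: lie_algebra K B by (rule LB)
  fix u assume u: "u \<in> fun_class n Y (f \<oplus>\<^bsub>P n\<^esub> g)"
  \<comment> \<open>The decomposition of \<open>u\<close> is \<open>(u - g) + g\<close>. The first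
    summand agrees with \<open>f\<close> on \<open>Y\<close> by cancellation in
    \<open>B\<close>.\<close>
  then obtain d where d: "d \<in> carrier (P n)" "d \<oplus>\<^bsub>P n\<^esub> g = u"
    using P_diff[OF _ g] by (auto simp: fun_class_def)
  have "eval n d p = eval n f p" if "p \<in> Y" for p
  proof -
    have p: "p \<in> affine_space B n" using that Y by auto
    have "eval n d p \<oplus>\<^bsub>B\<^esub> eval n g p = eval n f p \<oplus>\<^bsub>B\<^esub> eval n g p"
      using u that d f g p by (auto simp: fun_class_def simp flip: eval_morphism(2))
    then show ?thesis using eval_morphism(1)[OF p] d f g by simp
  qed
  then show "u \<in> fun_class n Y f <+>\<^bsub>P n\<^esub> fun_class n Y g"
    using d fun_class_self[OF g] by (auto simp: set_add_def' fun_class_def)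
qed

text \<open>A polynomial \<open>u\<close> agrees with \<open>f\<close> on \<open>Y\<close> exactly
  when \<open>u - f\<close> vanishes there.\<close>

lemma Rad_coset:
  assumes Y: "Y \<subseteq> affine_space B n" and f: "f \<in> carrier (P n)"
  shows "Rad K A B n Y +>\<^bsub>P n\<^esub> f = fun_class n Y f"
proof (intro equalityI subsetI)
  fix u assume "u \<in> Rad K A B n Y +>\<^bsub>P n\<^esub> f"
  then obtain r where r: "r \<in> Rad K A B n Y" "u = r \<oplus>\<^bsub>P n\<^esub> f" by (auto simp: a_r_coset_def')
  interpret B: lie_algebra K B by (rule LB)
  show "u \<in> fun_class n Y f"
    using r Y f by (auto simp: Rad_def fun_class_def P_closed eval_morphism subset_iff)
next
  interpret B: lie_algebra K B by (rule LB)
  fix u assume u: "u \<in> fun_class n Y f"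
  then obtain d where d: "d \<in> carrier (P n)" "d \<oplus>\<^bsub>P n\<^esub> f = u"
    using P_diff[OF _ f] by (auto simp: fun_class_def)
  have "eval n d p = \<zero>\<^bsub>B\<^esub>" if "p \<in> Y" for p
  proof -
    have p: "p \<in> affine_space B n" using that Y by auto
    have "eval n d p \<oplus>\<^bsub>B\<^esub> eval n f p = eval n f p"
      using u that d f p by (auto simp: fun_class_def simp flip: eval_morphism(2))
    then show ?thesis using eval_morphism(1)[OF p] d f by simp
  qed
  then show "u \<in> Rad K A B n Y +>\<^bsub>P n\<^esub> f"
    using d by (auto simp: a_r_coset_def' Rad_def)
qed

text \<open>The bracket and the scalar multiple of the quotient are unions over all representatives.
  The values of a bracket or multiple on \<open>Y\<close> depend only on the values of the operands,
  so every choice of representatives contributes the same class.\<close>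

lemma coordinate_algebra_ops:
  fixes n Y
  assumes Y: "Y \<subseteq> affine_space B n"
  defines "\<Gamma> \<equiv> coordinate_algebra K A B (n, Y)" and "cl \<equiv> fun_class n Y"
  shows "carrier \<Gamma> = cl ` carrier (P n)"
    and "\<lbrakk>f \<in> carrier (P n); g \<in> carrier (P n)\<rbrakk> \<Longrightarrow> cl f \<oplus>\<^bsub>\<Gamma>\<^esub> cl g = cl (f \<oplus>\<^bsub>P n\<^esub> g)"
    and "\<lbrakk>f \<in> carrier (P n); g \<in> carrier (P n)\<rbrakk> \<Longrightarrow> cl f \<otimes>\<^bsub>\<Gamma>\<^esub> cl g = cl (f \<otimes>\<^bsub>P n\<^esub> g)"
    and "\<lbrakk>c \<in> carrier K; f \<in> carrier (P n)\<rbrakk> \<Longrightarrow> c \<odot>\<^bsub>\<Gamma>\<^esub> cl f = cl (c \<odot>\<^bsub>P n\<^esub> f)"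
    and "\<zero>\<^bsub>\<Gamma>\<^esub> = cl \<zero>\<^bsub>P n\<^esub>"
    and "a \<in> carrier A \<Longrightarrow> emb \<Gamma> a = cl (emb (P n) a)"
proof -
  note defs = \<Gamma>_def cl_def coordinate_algebra_def alie_quotient_def
  note eval = eval_morphism[OF subsetD[OF Y]]
  show "carrier \<Gamma> = cl ` carrier (P n)"
    using Rad_coset[OF Y] by (auto simp: defs A_RCOSETS_def')
  show "cl f \<oplus>\<^bsub>\<Gamma>\<^esub> cl g = cl (f \<oplus>\<^bsub>P n\<^esub> g)" if "f \<in> carrier (P n)" "g \<in> carrier (P n)"
    using fun_class_set_add[OF Y that] by (simp add: defs)
  show "cl f \<otimes>\<^bsub>\<Gamma>\<^esub> cl g = cl (f \<otimes>\<^bsub>P n\<^esub> g)" if "f \<in> carrier (P n)" "g \<in> carrier (P n)"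
  proof -
    have "Rad K A B n Y +>\<^bsub>P n\<^esub> (f' \<otimes>\<^bsub>P n\<^esub> g') = cl (f \<otimes>\<^bsub>P n\<^esub> g)" if "f' \<in> cl f" "g' \<in> cl g" for f' g'
    proof -
      have c: "f' \<in> carrier (P n)" "g' \<in> carrier (P n)"
        using that by (auto simp: cl_def fun_class_def)
      have "cl (f' \<otimes>\<^bsub>P n\<^esub> g') = cl (f \<otimes>\<^bsub>P n\<^esub> g)"
        using that c \<open>f \<in> _\<close> \<open>g \<in> _\<close>
        by (auto simp: cl_def fun_class_eq_iff P_closed eval) (auto simp: fun_class_def)
      then show ?thesis using Rad_coset[OF Y P_closed(2)[OF c]] by (simp add: cl_def)
    qed
    note * = this
    have "cl f \<otimes>\<^bsub>\<Gamma>\<^esub> cl g = (\<Union>f'\<in>cl f. \<Union>g'\<in>cl g. Rad K A B n Y +>\<^bsub>P n\<^esub> (f' \<otimes>\<^bsub>P n\<^esub> g'))"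
      by (simp add: defs rcoset_mult_def)
    \<comment> \<open>The members of the union all equal one class, and \<open>f\<close> and
      \<open>g\<close> themselves show that the index sets are nonempty.\<close>
    then show ?thesis
      using that[THEN fun_class_self, of Y] * unfolding cl_def by auto
  qed
  show "c \<odot>\<^bsub>\<Gamma>\<^esub> cl f = cl (c \<odot>\<^bsub>P n\<^esub> f)" if "c \<in> carrier K" "f \<in> carrier (P n)"
  proof -
    have "Rad K A B n Y +>\<^bsub>P n\<^esub> (c \<odot>\<^bsub>P n\<^esub> f') = cl (c \<odot>\<^bsub>P n\<^esub> f)" if "f' \<in> cl f" for f'
    proof -
      have c: "f' \<in> carrier (P n)"
        using that by (auto simp: cl_def fun_class_def)
      have "cl (c \<odot>\<^bsub>P n\<^esub> f') = cl (c \<odot>\<^bsub>P n\<^esub> f)"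
        using that c \<open>f \<in> _\<close> \<open>c \<in> _\<close>
        by (auto simp: cl_def fun_class_eq_iff P_closed eval) (auto simp: fun_class_def)
      then show ?thesis using Rad_coset[OF Y P_closed(3)[OF \<open>c \<in> _\<close> c]] by (simp add: cl_def)
    qed
    note * = this
    have "c \<odot>\<^bsub>\<Gamma>\<^esub> cl f = (\<Union>f'\<in>cl f. Rad K A B n Y +>\<^bsub>P n\<^esub> (c \<odot>\<^bsub>P n\<^esub> f'))"
      by (simp add: defs)
    then show ?thesis
      using fun_class_self[OF that(2), of Y] * unfolding cl_def by auto
  qed
  show "\<zero>\<^bsub>\<Gamma>\<^esub> = cl \<zero>\<^bsub>P n\<^esub>"
    using Rad_eq_fun_class[OF Y] by (simp add: defs)
  show "emb \<Gamma> a = cl (emb (P n) a)" if "a \<in> carrier A"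
    using Rad_coset[OF Y emb_closed[OF that]] by (simp add: defs)
qed

section \<open>Coordinate algebras of algebraic sets, and the role of the empty set\<close>

abbreviation "\<Gamma> \<equiv> coordinate_algebra K A B"
abbreviation "cls V \<equiv> fun_class (fst V) (snd V)"
abbreviation "alg \<equiv> algebraic_sets K A B"

lemma alg_affine: "Y \<in> alg \<Longrightarrow> snd Y \<subseteq> affine_space B (fst Y)"
  by (auto simp: algebraic_sets_def zero_set_def)

lemma \<Gamma>_ops:
  assumes "V \<in> alg"
  shows "carrier (\<Gamma> V) = cls V ` carrier (P (fst V))"
    and "\<lbrakk>f \<in> carrier (P (fst V)); g \<in> carrier (P (fst V))\<rbrakk> \<Longrightarrow>
      cls V f \<oplus>\<^bsub>\<Gamma> V\<^esub> cls V g = cls V (f \<oplus>\<^bsub>P (fst V)\<^esub> g)"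
    and "\<lbrakk>f \<in> carrier (P (fst V)); g \<in> carrier (P (fst V))\<rbrakk> \<Longrightarrow>
      cls V f \<otimes>\<^bsub>\<Gamma> V\<^esub> cls V g = cls V (f \<otimes>\<^bsub>P (fst V)\<^esub> g)"
    and "\<lbrakk>c \<in> carrier K; f \<in> carrier (P (fst V))\<rbrakk> \<Longrightarrow>
      c \<odot>\<^bsub>\<Gamma> V\<^esub> cls V f = cls V (c \<odot>\<^bsub>P (fst V)\<^esub> f)"
    and "\<zero>\<^bsub>\<Gamma> V\<^esub> = cls V \<zero>\<^bsub>P (fst V)\<^esub>"
    and "a \<in> carrier A \<Longrightarrow> emb (\<Gamma> V) a = cls V (emb (P (fst V)) a)"
  using coordinate_algebra_ops[OF alg_affine[OF assms]] by simp_all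

lemma \<Gamma>_closed:
  assumes "V \<in> alg"
  shows "\<lbrakk>x \<in> carrier (\<Gamma> V); y \<in> carrier (\<Gamma> V)\<rbrakk> \<Longrightarrow> x \<oplus>\<^bsub>\<Gamma> V\<^esub> y \<in> carrier (\<Gamma> V)"
    and "\<lbrakk>x \<in> carrier (\<Gamma> V); y \<in> carrier (\<Gamma> V)\<rbrakk> \<Longrightarrow> x \<otimes>\<^bsub>\<Gamma> V\<^esub> y \<in> carrier (\<Gamma> V)"
    and "\<lbrakk>c \<in> carrier K; x \<in> carrier (\<Gamma> V)\<rbrakk> \<Longrightarrow> c \<odot>\<^bsub>\<Gamma> V\<^esub> x \<in> carrier (\<Gamma> V)"
    and "a \<in> carrier A \<Longrightarrow> emb (\<Gamma> V) a \<in> carrier (\<Gamma> V)"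
  by (auto simp: \<Gamma>_ops[OF assms] P_closed emb_closed)

text \<open>The zero algebra is the coordinate algebra of a nonempty set only if \<open>A = 0\<close>, and then every
  algebraic set contains the origin.\<close>

lemma eval_origin:
  assumes e: "\<And>a. a \<in> carrier A \<Longrightarrow> emb B a = \<zero>\<^bsub>B\<^esub>" and f: "f \<in> carrier (P n)"
  shows "eval n f (replicate n \<zero>\<^bsub>B\<^esub>) = \<zero>\<^bsub>B\<^esub>"
proof -
  interpret B: lie_algebra K B by (rule LB)
  let ?h = "\<lambda>f\<in>carrier (P n). \<zero>\<^bsub>B\<^esub>"
  have p: "replicate n \<zero>\<^bsub>B\<^esub> \<in> affine_space B n" by (auto simp: affine_space_def)
  \<comment> \<open>The zero map is compatible with the embeddings because \<open>emb B\<close> is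
    zero on \<open>A\<close>.\<close>
  have "?h \<in> A_hom K A (P n) B"
    by (auto simp: A_hom_def lie_hom_def P_closed emb_closed e B.bracket_self)
  then have "eval n f (replicate n \<zero>\<^bsub>B\<^esub>) = ?h f"
    by (rule lpoly_eval_eqI[OF B p]) (simp add: var_closed)
  then show ?thesis using f by simp
qed

text \<open>\<open>CA_hom\<close> tests emptiness on the algebra and \<open>AS_hom\<close> on the
  set. The two tests have to agree for the hom-sets to correspond.\<close>

lemma empty_coordinate_algebras_iff:
  assumes Y: "Y \<in> alg"
  shows "\<Gamma> Y \<in> empty_coordinate_algebras K A B \<longleftrightarrow> snd Y = {}"
proof
  assume "\<Gamma> Y \<in> empty_coordinate_algebras K A B"
  then obtain Z where Z: "Z \<in> alg" "snd Z = {}" "\<Gamma> Y = \<Gamma> Z"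
    by (auto simp: empty_coordinate_algebras_def)
  show "snd Y = {}"
  proof (rule ccontr)
    assume "snd Y \<noteq> {}"
    then obtain p where p: "p \<in> snd Y" by blast
    then have pa: "p \<in> affine_space B (fst Y)" using alg_affine[OF Y] by blast
    have e: "emb B a = \<zero>\<^bsub>B\<^esub>" if a: "a \<in> carrier A" for a
    proof -
      \<comment> \<open>Over the empty set there is only one class, so the embedding into
        \<open>\<Gamma> Z\<close> is zero. The equality with \<open>\<Gamma> Y\<close> carries this
        over, and evaluation at \<open>p\<close> brings it down to \<open>B\<close>.\<close>
      have "emb (\<Gamma> Z) a = \<zero>\<^bsub>\<Gamma> Z\<^esub>"
        using \<Gamma>_ops(5,6)[OF Z(1)] a Z(2) by (simp add: fun_class_def)
      then have "cls Y (emb (P (fst Y)) a) = cls Y \<zero>\<^bsub>P (fst Y)\<^esub>"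
        using \<Gamma>_ops(5,6)[OF Y] a Z(3) by simp
      then have "eval (fst Y) (emb (P (fst Y)) a) p = eval (fst Y) \<zero>\<^bsub>P (fst Y)\<^esub> p"
        using p a by (simp add: fun_class_eq_iff emb_closed P_closed)
      then show ?thesis using pa a by (simp add: eval_morphism eval_zero)
    qed
    obtain S where S: "S \<subseteq> carrier (P (fst Z))" "snd Z = zero_set K A B (fst Z) S"
      using Z(1) by (auto simp: algebraic_sets_def)
    interpret B: lie_algebra K B by (rule LB)
    \<comment> \<open>Every polynomial vanishes at the origin, so the origin solves the system
      \<open>S\<close> that defines the supposedly empty \<open>Z\<close>.\<close>
    have "replicate (fst Z) \<zero>\<^bsub>B\<^esub> \<in> snd Z"
      using S eval_origin[OF e] by (auto simp: zero_set_def affine_space_def)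
    then show False using Z(2) by simp
  qed
next
  assume "snd Y = {}"
  then show "\<Gamma> Y \<in> empty_coordinate_algebras K A B"
    using Y by (auto simp: empty_coordinate_algebras_def)
qed

section \<open>The two categories\<close>

text \<open>Substituting the coordinate polynomials of \<open>\<psi>\<close> into \<open>g\<close>
  gives a polynomial that induces \<open>g\<close> after \<open>\<psi>\<close>.\<close>

lemma AS_hom_subst:
  assumes Y: "Y \<in> alg" and \<psi>: "\<psi> \<in> AS_hom K A B Y Z" and g: "g \<in> carrier (P (fst Z))"
  obtains g' where "g' \<in> carrier (P (fst Y))"
    and "\<And>p. p \<in> snd Y \<Longrightarrow> eval (fst Y) g' p = eval (fst Z) g (\<psi> p)"
proof -
  obtain fs where fs: "length fs = fst Z" "set fs \<subseteq> carrier (P (fst Y))"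
    "\<And>p. p \<in> snd Y \<Longrightarrow> \<psi> p = map (\<lambda>f. eval (fst Y) f p) fs"
    using \<psi> by (auto simp: AS_hom_def)
  have "fs \<in> affine_space (P (fst Y)) (fst Z)" using fs by (simp add: affine_space_def)
  then have "lpoly_eval K A (P (fst Y)) (fst Z) g fs \<in> carrier (P (fst Y))"
    using g by (rule lpoly_eval_closed[OF P_A_lie])
  moreover have "eval (fst Y) (lpoly_eval K A (P (fst Y)) (fst Z) g fs) p = eval (fst Z) g (\<psi> p)"
    if "p \<in> snd Y" for p
    using eval_subst[of p "fst Y" fs g] fs g that alg_affine[OF Y] by auto
  ultimately show ?thesis by (rule that)
qed

text \<open>Applied to the variables, the hypothesis \<open>ex\<close> produces coordinate
  polynomials for \<open>\<psi>\<close>. With \<open>AS_hom_subst\<close> this gives a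
  coordinate-free criterion: morphisms are the maps along which polynomial functions pull back to
  polynomial functions.\<close>

lemma AS_homI:
  assumes Z: "Z \<in> alg" and \<psi>: "\<psi> \<in> snd Y \<rightarrow>\<^sub>E snd Z" and e: "snd Y = {} \<Longrightarrow> snd Z = {}"
    and ex: "\<And>g. g \<in> carrier (P (fst Z)) \<Longrightarrow>
      \<exists>g'\<in>carrier (P (fst Y)). \<forall>p\<in>snd Y. eval (fst Y) g' p = eval (fst Z) g (\<psi> p)"
  shows "\<psi> \<in> AS_hom K A B Y Z"
proof -
  let ?x = "lpoly_var K A (fst Z)"
  have "\<exists>f. \<forall>i\<in>{..<fst Z}. f i \<in> carrier (P (fst Y)) \<and>
      (\<forall>p\<in>snd Y. eval (fst Y) (f i) p = eval (fst Z) (?x i) (\<psi> p))"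
    by (rule bchoice) (use ex[OF var_closed] in \<open>simp add: Bex_def\<close>)
  then obtain f where f: "\<And>i. i < fst Z \<Longrightarrow> f i \<in> carrier (P (fst Y))"
    "\<And>i p. i < fst Z \<Longrightarrow> p \<in> snd Y \<Longrightarrow> eval (fst Y) (f i) p = eval (fst Z) (?x i) (\<psi> p)"
    by auto
  have "\<psi> p = map (\<lambda>f. eval (fst Y) f p) (map f [0..<fst Z])" if p: "p \<in> snd Y" for p
  proof -
    have q: "\<psi> p \<in> affine_space B (fst Z)" using \<psi> p alg_affine[OF Z] by blast
    then show ?thesis
      using f(2)[OF _ p] eval_var[OF q] by (auto simp: affine_space_def intro!: nth_equalityI)
  qed
  then show ?thesis
    unfolding AS_hom_def using \<psi> e f(1) by (auto intro!: exI[of _ "map f [0..<fst Z]"])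
qed

section \<open>The category axioms\<close>

lemma category_AS: "category (AS K A B)"
proof
  fix X Y Z and f g :: "'b list \<Rightarrow> 'b list"
  assume *: "X \<in> Ob (AS K A B)" "Y \<in> Ob (AS K A B)" "Z \<in> Ob (AS K A B)"
    "f \<in> Hom (AS K A B) X Y" "g \<in> Hom (AS K A B) Y Z"
  then have alg: "X \<in> alg" "Y \<in> alg" "Z \<in> alg"
    and f: "f \<in> snd X \<rightarrow>\<^sub>E snd Y" "snd X = {} \<longrightarrow> snd Y = {}"
    and g: "g \<in> snd Y \<rightarrow>\<^sub>E snd Z" "snd Y = {} \<longrightarrow> snd Z = {}"
    by (auto simp: AS_def AS_hom_def)
  \<comment> \<open>By the coordinate-free criterion it suffices to pull \<open>h\<close> back along
    \<open>g\<close> and the result along \<open>f\<close>.\<close>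
  have "\<exists>h''\<in>carrier (P (fst X)). \<forall>p\<in>snd X. eval (fst X) h'' p = eval (fst Z) h (compose (snd X) g f p)"
    if h: "h \<in> carrier (P (fst Z))" for h
  proof -
    obtain h' where h': "h' \<in> carrier (P (fst Y))"
      "\<And>p. p \<in> snd Y \<Longrightarrow> eval (fst Y) h' p = eval (fst Z) h (g p)"
      using AS_hom_subst[OF alg(2) _ h, of g] * by (auto simp: AS_def)
    obtain h'' where h'': "h'' \<in> carrier (P (fst X))"
      "\<And>p. p \<in> snd X \<Longrightarrow> eval (fst X) h'' p = eval (fst Y) h' (f p)"
      using AS_hom_subst[OF alg(1) _ h'(1), of f] * by (auto simp: AS_def)
    show ?thesis
      using h'' h'(2) f(1) by (intro bexI[of _ h'']) (auto simp: compose_eq)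
  qed
  moreover have "compose (snd X) g f \<in> snd X \<rightarrow>\<^sub>E snd Z"
    using f(1) g(1) by (auto simp: compose_def)
  ultimately show "Comp (AS K A B) X Y Z g f \<in> Hom (AS K A B) X Z"
    using f(2) g(2) AS_homI[OF alg(3)] by (simp add: AS_def)
next
  fix X assume "X \<in> Ob (AS K A B)"
  then show "Id (AS K A B) X \<in> Hom (AS K A B) X X"
    using AS_homI[of X "restrict id (snd X)" X] by (auto simp: AS_def)
next
  fix X Y and f :: "'b list \<Rightarrow> 'b list"
  assume "f \<in> Hom (AS K A B) X Y"
  then have "f \<in> snd X \<rightarrow>\<^sub>E snd Y" by (auto simp: AS_def AS_hom_def)
  then show "Comp (AS K A B) X X Y f (Id (AS K A B) X) = f"
    "Comp (AS K A B) X Y Y (Id (AS K A B) Y) f = f"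
    by (auto simp: AS_def compose_def fun_eq_iff PiE_iff extensional_def)
next
  fix W X Y Z and f g h :: "'b list \<Rightarrow> 'b list"
  assume "f \<in> Hom (AS K A B) W X"
  then have "f \<in> snd W \<rightarrow> snd X" by (auto simp: AS_def AS_hom_def)
  then show "Comp (AS K A B) W Y Z h (Comp (AS K A B) W X Y g f) =
      Comp (AS K A B) W X Z (Comp (AS K A B) X Y Z h g) f"
    by (simp add: AS_def compose_assoc)
qed

lemma category_CA: "category (CA K A B)"
proof
  fix X Y Z and f g :: "('k, 'a) lpoly set \<Rightarrow> ('k, 'a) lpoly set"
  assume *: "X \<in> Ob (CA K A B)" "f \<in> Hom (CA K A B) X Y" "g \<in> Hom (CA K A B) Y Z"
  then obtain V where V: "V \<in> alg" "X = \<Gamma> V" by (auto simp: CA_def)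
  \<comment> \<open>Both hom-sets are inhabited, so the emptiness test has the same outcome on
    \<open>X\<close>, \<open>Y\<close> and \<open>Z\<close>.\<close>
  have f: "f \<in> A_hom K A X Y" and g: "g \<in> A_hom K A Y Z"
    and e: "X \<in> empty_coordinate_algebras K A B \<longleftrightarrow> Z \<in> empty_coordinate_algebras K A B"
    using * by (auto simp: CA_def CA_hom_def split: if_splits)
  have "compose (carrier X) g f \<in> A_hom K A X Z"
    using f g \<Gamma>_closed[OF V(1)] unfolding V(2)
    by (auto simp: A_hom_def lie_hom_def compose_def PiE_iff Pi_iff)
  then show "Comp (CA K A B) X Y Z g f \<in> Hom (CA K A B) X Z"
    using e by (simp add: CA_def CA_hom_def)
next
  fix X assume "X \<in> Ob (CA K A B)"
  then obtain V where "V \<in> alg" "X = \<Gamma> V" by (auto simp: CA_def)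
  then show "Id (CA K A B) X \<in> Hom (CA K A B) X X"
    by (auto simp: CA_def CA_hom_def A_hom_def lie_hom_def \<Gamma>_closed)
next
  fix X Y and f :: "('k, 'a) lpoly set \<Rightarrow> ('k, 'a) lpoly set"
  assume "f \<in> Hom (CA K A B) X Y"
  then have "f \<in> carrier X \<rightarrow>\<^sub>E carrier Y"
    by (auto simp: CA_def CA_hom_def A_hom_def lie_hom_def split: if_splits)
  then show "Comp (CA K A B) X X Y f (Id (CA K A B) X) = f"
    "Comp (CA K A B) X Y Y (Id (CA K A B) Y) f = f"
    by (auto simp: CA_def compose_def fun_eq_iff PiE_iff extensional_def)
next
  fix W X Y Z and f g h :: "('k, 'a) lpoly set \<Rightarrow> ('k, 'a) lpoly set"
  assume "f \<in> Hom (CA K A B) W X"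
  then have "f \<in> carrier W \<rightarrow> carrier X"
    by (auto simp: CA_def CA_hom_def A_hom_def lie_hom_def split: if_splits)
  then show "Comp (CA K A B) W Y Z h (Comp (CA K A B) W X Y g f) =
      Comp (CA K A B) W X Z (Comp (CA K A B) X Y Z h g) f"
    by (simp add: CA_def compose_assoc)
qed

section \<open>Duality\<close>

text \<open>Quantifying over all members \<open>g\<close> of \<open>U\<close> avoids a choice of
  representative. The target \<open>Z\<close> comes first because this is the morphism map of a
  functor on the opposite category, where \<open>\<psi>\<close> goes from \<open>Z\<close> to
  \<open>Y\<close>.\<close>

definition pullback ::
    "nat \<times> 'b list set \<Rightarrow> nat \<times> 'b list set \<Rightarrow> ('b list \<Rightarrow> 'b list)
      \<Rightarrow> ('k, 'a) lpoly set \<Rightarrow> ('k, 'a) lpoly set"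
  where "pullback Z Y \<psi> = (\<lambda>U\<in>carrier (\<Gamma> Z).
    {f \<in> carrier (P (fst Y)). \<forall>p\<in>snd Y. \<forall>g\<in>U. eval (fst Y) f p = eval (fst Z) g (\<psi> p)})"

text \<open>The members of \<open>cls Z g\<close> agree on \<open>Z\<close>, where
  \<open>\<psi>\<close> takes its values, so the condition on all of them reduces to the one on
  \<open>g\<close>.\<close>

lemma pullback_cls:
  assumes Z: "Z \<in> alg" and \<psi>: "\<psi> \<in> snd Y \<rightarrow> snd Z"
    and g: "g \<in> carrier (P (fst Z))"
    and g': "\<And>p. p \<in> snd Y \<Longrightarrow> eval (fst Y) g' p = eval (fst Z) g (\<psi> p)"
  shows "pullback Z Y \<psi> (cls Z g) = cls Y g'"
proof -
  have "eval (fst Z) u (\<psi> p) = eval (fst Y) g' p" if "u \<in> cls Z g" "p \<in> snd Y" for u p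
    using that \<psi> g' by (auto simp: fun_class_def)
  moreover have "g \<in> cls Z g" using g by (rule fun_class_self)
  moreover have "cls Z g \<in> carrier (\<Gamma> Z)" using g by (simp add: \<Gamma>_ops[OF Z])
  ultimately show ?thesis
    by (auto simp: pullback_def fun_class_def[of "fst Y"])
qed

text \<open>Operations on classes are pointwise operations on functions, and these commute with
  precomposition by \<open>\<psi>\<close>.\<close>

lemma pullback_in_Hom:
  assumes Y: "Y \<in> alg" and Z: "Z \<in> alg" and \<psi>: "\<psi> \<in> AS_hom K A B Y Z"
  shows "pullback Z Y \<psi> \<in> CA_hom K A B (\<Gamma> Z) (\<Gamma> Y)"
proof -
  \<comment> \<open>One direction of \<open>e\<close> is the emptiness condition in
    \<open>AS_hom\<close>. The other holds because a nonempty set has no map to the empty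
    one.\<close>
  have map: "\<psi> \<in> snd Y \<rightarrow> snd Z" and e: "snd Z = {} \<longleftrightarrow> snd Y = {}"
    using \<psi> by (auto simp: AS_hom_def)
  note pb = pullback_cls[OF Z map]
  note ev = eval_morphism[OF subsetD[OF alg_affine[OF Y]]]
    eval_morphism[OF subsetD[OF alg_affine[OF Z]], OF funcset_mem[OF map]]
  have "pullback Z Y \<psi> U \<in> carrier (\<Gamma> Y)" if U: "U \<in> carrier (\<Gamma> Z)" for U
  proof -
    obtain g where g: "g \<in> carrier (P (fst Z))" "U = cls Z g" using U \<Gamma>_ops(1)[OF Z] by auto
    obtain g' where "g' \<in> carrier (P (fst Y))"
      "\<And>p. p \<in> snd Y \<Longrightarrow> eval (fst Y) g' p = eval (fst Z) g (\<psi> p)"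
      using AS_hom_subst[OF Y \<psi> g(1)] by blast
    then show ?thesis using pb[of g g'] g \<Gamma>_ops(1)[OF Y] by simp
  qed
  then have "pullback Z Y \<psi> \<in> carrier (\<Gamma> Z) \<rightarrow>\<^sub>E carrier (\<Gamma> Y)"
    by (auto simp: pullback_def)
  moreover have "pullback Z Y \<psi> (U \<oplus>\<^bsub>\<Gamma> Z\<^esub> V) = pullback Z Y \<psi> U \<oplus>\<^bsub>\<Gamma> Y\<^esub> pullback Z Y \<psi> V"
    "pullback Z Y \<psi> (U \<otimes>\<^bsub>\<Gamma> Z\<^esub> V) = pullback Z Y \<psi> U \<otimes>\<^bsub>\<Gamma> Y\<^esub> pullback Z Y \<psi> V"
    if UV: "U \<in> carrier (\<Gamma> Z)" "V \<in> carrier (\<Gamma> Z)" for U V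
  proof -
    obtain f g where g: "f \<in> carrier (P (fst Z))" "U = cls Z f" "g \<in> carrier (P (fst Z))" "V = cls Z g"
      using UV \<Gamma>_ops(1)[OF Z] by auto
    obtain f' g' where g': "f' \<in> carrier (P (fst Y))" "g' \<in> carrier (P (fst Y))"
      "\<And>p. p \<in> snd Y \<Longrightarrow> eval (fst Y) f' p = eval (fst Z) f (\<psi> p)"
      "\<And>p. p \<in> snd Y \<Longrightarrow> eval (fst Y) g' p = eval (fst Z) g (\<psi> p)"
      using AS_hom_subst[OF Y \<psi> g(1)] AS_hom_subst[OF Y \<psi> g(3)] by metis
    have pb_UV: "pullback Z Y \<psi> U = cls Y f'" "pullback Z Y \<psi> V = cls Y g'"
      using g g' by (auto intro!: pb)
    show "pullback Z Y \<psi> (U \<oplus>\<^bsub>\<Gamma> Z\<^esub> V) = pullback Z Y \<psi> U \<oplus>\<^bsub>\<Gamma> Y\<^esub> pullback Z Y \<psi> V"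
      using pb[of "f \<oplus>\<^bsub>P (fst Z)\<^esub> g" "f' \<oplus>\<^bsub>P (fst Y)\<^esub> g'"] g(1,3) g'
      by (simp add: pb_UV) (simp add: g \<Gamma>_ops[OF Z] \<Gamma>_ops[OF Y] P_closed ev)
    show "pullback Z Y \<psi> (U \<otimes>\<^bsub>\<Gamma> Z\<^esub> V) = pullback Z Y \<psi> U \<otimes>\<^bsub>\<Gamma> Y\<^esub> pullback Z Y \<psi> V"
      using pb[of "f \<otimes>\<^bsub>P (fst Z)\<^esub> g" "f' \<otimes>\<^bsub>P (fst Y)\<^esub> g'"] g(1,3) g'
      by (simp add: pb_UV) (simp add: g \<Gamma>_ops[OF Z] \<Gamma>_ops[OF Y] P_closed ev)
  qed
  moreover have "pullback Z Y \<psi> (c \<odot>\<^bsub>\<Gamma> Z\<^esub> U) = c \<odot>\<^bsub>\<Gamma> Y\<^esub> pullback Z Y \<psi> U"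
    if c: "c \<in> carrier K" and U: "U \<in> carrier (\<Gamma> Z)" for c U
  proof -
    obtain f where f: "f \<in> carrier (P (fst Z))" "U = cls Z f"
      using U \<Gamma>_ops(1)[OF Z] by auto
    obtain f' where f': "f' \<in> carrier (P (fst Y))"
      "\<And>p. p \<in> snd Y \<Longrightarrow> eval (fst Y) f' p = eval (fst Z) f (\<psi> p)"
      using AS_hom_subst[OF Y \<psi> f(1)] by metis
    have pb_U: "pullback Z Y \<psi> U = cls Y f'"
      using f f' by (auto intro!: pb)
    show ?thesis
      using pb[of "c \<odot>\<^bsub>P (fst Z)\<^esub> f" "c \<odot>\<^bsub>P (fst Y)\<^esub> f'"] f(1) f' c
      by (simp add: pb_U) (simp add: f \<Gamma>_ops[OF Z] \<Gamma>_ops[OF Y] P_closed ev)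
  qed
  moreover have "pullback Z Y \<psi> (emb (\<Gamma> Z) a) = emb (\<Gamma> Y) a" if "a \<in> carrier A" for a
    using pb[of "emb (P (fst Z)) a" "emb (P (fst Y)) a"] that
    by (simp add: \<Gamma>_ops[OF Z] \<Gamma>_ops[OF Y] emb_closed ev)
  ultimately show ?thesis
    using e by (simp add: CA_hom_def A_hom_def lie_hom_def empty_coordinate_algebras_iff Y Z)
qed

lemma pullback_eqI:
  assumes Z: "Z \<in> alg" and h: "h \<in> extensional (carrier (\<Gamma> Z))"
    and eq: "\<And>g. g \<in> carrier (P (fst Z)) \<Longrightarrow> pullback Z Y \<psi> (cls Z g) = h (cls Z g)"
  shows "pullback Z Y \<psi> = h"
proof (rule extensionalityI[OF _ h])
  show "pullback Z Y \<psi> \<in> extensional (carrier (\<Gamma> Z))" by (simp add: pullback_def)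
qed (auto simp: \<Gamma>_ops[OF Z] eq)

section \<open>Full faithfulness of the pullback\<close>

lemma pullback_inj:
  assumes Y: "Y \<in> alg" and Z: "Z \<in> alg"
  shows "inj_on (pullback Z Y) (AS_hom K A B Y Z)"
proof (rule inj_onI)
  fix \<phi> \<psi>
  assume \<phi>: "\<phi> \<in> AS_hom K A B Y Z" and \<psi>: "\<psi> \<in> AS_hom K A B Y Z"
    and eq: "pullback Z Y \<phi> = pullback Z Y \<psi>"
  have maps: "\<phi> \<in> snd Y \<rightarrow>\<^sub>E snd Z" "\<psi> \<in> snd Y \<rightarrow>\<^sub>E snd Z"
    using \<phi> \<psi> by (auto simp: AS_hom_def)
  show "\<phi> = \<psi>"
  proof (rule PiE_ext[OF maps])
    fix p assume p: "p \<in> snd Y"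
    then have q: "\<phi> p \<in> affine_space B (fst Z)" "\<psi> p \<in> affine_space B (fst Z)"
      using maps alg_affine[OF Z] by blast+
    have "\<phi> p ! i = \<psi> p ! i" if i: "i < fst Z" for i
    proof -
      let ?x = "lpoly_var K A (fst Z) i"
      have x: "?x \<in> carrier (P (fst Z))" using i by (rule var_closed)
      obtain f where f: "f \<in> carrier (P (fst Y))"
        "\<And>p. p \<in> snd Y \<Longrightarrow> eval (fst Y) f p = eval (fst Z) ?x (\<phi> p)"
        using AS_hom_subst[OF Y \<phi> x] by blast
      obtain g where g: "g \<in> carrier (P (fst Y))"
        "\<And>p. p \<in> snd Y \<Longrightarrow> eval (fst Y) g p = eval (fst Z) ?x (\<psi> p)"
        using AS_hom_subst[OF Y \<psi> x] by blast
      \<comment> \<open>Both are the image of the class of the \<open>i\<close>-th variable under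
        the common pullback. Evaluated at \<open>p\<close>, they give the \<open>i\<close>-th
        coordinates of \<open>\<phi> p\<close> and \<open>\<psi> p\<close>.\<close>
      have "cls Y f = cls Y g"
        using pullback_cls[OF Z _ x f(2)] pullback_cls[OF Z _ x g(2)] maps eq by auto
      then show ?thesis
        using p f g fun_class_eq_iff eval_var[OF q(1) i] eval_var[OF q(2) i] by metis
    qed
    then show "\<phi> p = \<psi> p"
      using q by (auto simp: affine_space_def intro!: nth_equalityI)
  qed
qed

text \<open>A homomorphism \<open>h : \<Gamma> Z \<rightarrow> \<Gamma> Y\<close> is the pullback along the map whose coordinates represent
  the images under \<open>h\<close> of the classes of the variables.\<close>

lemma pullback_surj:
  assumes Y: "Y \<in> alg" and Z: "Z \<in> alg" and h: "h \<in> CA_hom K A B (\<Gamma> Z) (\<Gamma> Y)"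
  shows "h \<in> pullback Z Y ` AS_hom K A B Y Z"
proof -
  let ?m = "fst Z" and ?n = "fst Y"
  have hA: "h \<in> A_hom K A (\<Gamma> Z) (\<Gamma> Y)" and e: "snd Z = {} \<longleftrightarrow> snd Y = {}"
    using h by (auto simp: CA_hom_def empty_coordinate_algebras_iff Y Z split: if_splits)
  have "\<forall>g\<in>carrier (P ?m). \<exists>f\<in>carrier (P ?n). h (cls Z g) = cls Y f"
    using hA by (fastforce simp: A_hom_def lie_hom_def PiE_iff \<Gamma>_ops(1)[OF Z] \<Gamma>_ops(1)[OF Y])
  \<comment> \<open>\<open>r\<close> lifts \<open>h\<close> to polynomials by arbitrary choices. It
    need not be a homomorphism, but the values of \<open>r g\<close> on \<open>Y\<close> are
    determined by \<open>h\<close>.\<close>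
  then obtain r where r: "\<And>g. g \<in> carrier (P ?m) \<Longrightarrow> r g \<in> carrier (P ?n)"
    "\<And>g. g \<in> carrier (P ?m) \<Longrightarrow> h (cls Z g) = cls Y (r g)"
    by metis
  define \<psi> where "\<psi> = (\<lambda>p\<in>snd Y. map (\<lambda>i. eval ?n (r (lpoly_var K A ?m i)) p) [0..<?m])"
  have \<psi>_affine: "\<psi> p \<in> affine_space B ?m" if "p \<in> snd Y" for p
    using that alg_affine[OF Y] var_closed r(1)
    by (auto simp: \<psi>_def affine_space_def intro!: eval_morphism(1))
  have eval_r: "eval ?m g (\<psi> p) = eval ?n (r g) p"
    if g: "g \<in> carrier (P ?m)" and p: "p \<in> snd Y" for g p
  proof -
    \<comment> \<open>For fixed \<open>p\<close>, the value of \<open>r g\<close> at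
      \<open>p\<close> turns out to be an \<open>A\<close>-homomorphism in \<open>g\<close>. It
      sends the variables to the coordinates of \<open>\<psi> p\<close>, hence is evaluation at
      \<open>\<psi> p\<close>.\<close>
    let ?k = "\<lambda>g\<in>carrier (P ?m). eval ?n (r g) p"
    have pa: "p \<in> affine_space B ?n" using p alg_affine[OF Y] by blast
    \<comment> \<open>The chosen representative may be replaced by any other of its class, in
      particular by the sum, bracket or multiple of chosen ones.\<close>
    have r_eq: "eval ?n (r u) p = eval ?n v p"
      if "u \<in> carrier (P ?m)" "v \<in> carrier (P ?n)" "h (cls Z u) = cls Y v" for u v
      using that p r fun_class_eq_iff[of "r u" ?n v "snd Y"] by auto
    have "?k \<in> A_hom K A (P ?m) B"
      unfolding A_hom_def lie_hom_def
    proof (intro CollectI conjI ballI)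
      show "?k \<in> carrier (P ?m) \<rightarrow>\<^sub>E carrier B"
        using r(1) eval_morphism(1)[OF pa] by auto
      have "h (cls Z (u \<oplus>\<^bsub>P ?m\<^esub> v)) = cls Y (r u \<oplus>\<^bsub>P ?n\<^esub> r v)"
        "h (cls Z (u \<otimes>\<^bsub>P ?m\<^esub> v)) = cls Y (r u \<otimes>\<^bsub>P ?n\<^esub> r v)"
        if "u \<in> carrier (P ?m)" "v \<in> carrier (P ?m)" for u v
        using hA that r
        by (simp_all add: A_hom_def lie_hom_def \<Gamma>_ops(1) Z flip: \<Gamma>_ops(2,3)[OF Z] \<Gamma>_ops(2,3)[OF Y])
      then show "?k (u \<oplus>\<^bsub>P ?m\<^esub> v) = ?k u \<oplus>\<^bsub>B\<^esub> ?k v" "?k (u \<otimes>\<^bsub>P ?m\<^esub> v) = ?k u \<otimes>\<^bsub>B\<^esub> ?k v"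
        if "u \<in> carrier (P ?m)" "v \<in> carrier (P ?m)" for u v
        using that r(1) r_eq[of "u \<oplus>\<^bsub>P ?m\<^esub> v" "r u \<oplus>\<^bsub>P ?n\<^esub> r v"]
          r_eq[of "u \<otimes>\<^bsub>P ?m\<^esub> v" "r u \<otimes>\<^bsub>P ?n\<^esub> r v"]
        by (simp_all add: P_closed eval_morphism pa)
      show "?k (c \<odot>\<^bsub>P ?m\<^esub> u) = c \<odot>\<^bsub>B\<^esub> ?k u" if "c \<in> carrier K" "u \<in> carrier (P ?m)" for c u
      proof -
        have "h (cls Z (c \<odot>\<^bsub>P ?m\<^esub> u)) = cls Y (c \<odot>\<^bsub>P ?n\<^esub> r u)"
          using hA that r
          by (simp add: A_hom_def lie_hom_def \<Gamma>_ops(1) Z flip: \<Gamma>_ops(4)[OF Z] \<Gamma>_ops(4)[OF Y])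
        then show ?thesis
          using that r(1) r_eq[of "c \<odot>\<^bsub>P ?m\<^esub> u" "c \<odot>\<^bsub>P ?n\<^esub> r u"]
          by (simp add: P_closed eval_morphism pa)
      qed
      show "?k (emb (P ?m) a) = emb B a" if "a \<in> carrier A" for a
      proof -
        have "h (cls Z (emb (P ?m) a)) = cls Y (emb (P ?n) a)"
          using hA that by (simp add: A_hom_def flip: \<Gamma>_ops(6)[OF Z] \<Gamma>_ops(6)[OF Y])
        then show ?thesis
          using that r_eq[of "emb (P ?m) a" "emb (P ?n) a"] by (simp add: emb_closed eval_morphism pa)
      qed
    qed
    then have "eval ?m g (\<psi> p) = ?k g"
      by (rule lpoly_eval_eqI[OF B \<psi>_affine[OF p]]) (simp add: \<psi>_def p var_closed)
    then show ?thesis using g by simp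
  qed
  have "\<psi> p \<in> snd Z" if p: "p \<in> snd Y" for p
  proof -
    obtain S where S: "S \<subseteq> carrier (P ?m)" "snd Z = zero_set K A B ?m S"
      using Z by (auto simp: algebraic_sets_def)
    have "eval ?m s (\<psi> p) = \<zero>\<^bsub>B\<^esub>" if "s \<in> S" for s
    proof -
      have s: "s \<in> carrier (P ?m)" using that S by blast
      \<comment> \<open>An equation \<open>s\<close> of \<open>Z\<close> has the same class as zero,
        so \<open>r s\<close> and \<open>r \<zero>\<close> have the same value at \<open>p\<close>.
        By \<open>eval_r\<close> these are the values of \<open>s\<close> and of zero at
        \<open>\<psi> p\<close>.\<close>
      have "\<forall>q\<in>snd Z. eval ?m s q = eval ?m \<zero>\<^bsub>P ?m\<^esub> q"
        using that alg_affine[OF Z] by (auto simp: S(2) zero_set_def eval_zero)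
      then have "cls Z s = cls Z \<zero>\<^bsub>P ?m\<^esub>"
        using fun_class_eq_iff[OF s P_closed(4)] by blast
      then have "cls Y (r s) = cls Y (r \<zero>\<^bsub>P ?m\<^esub>)"
        using r(2)[OF s] r(2)[OF P_closed(4)] by simp
      then have "eval ?n (r s) p = eval ?n (r \<zero>\<^bsub>P ?m\<^esub>) p"
        using fun_class_eq_iff[OF r(1)[OF s] r(1)[OF P_closed(4)]] p by blast
      then show ?thesis
        using eval_r[OF s p] eval_r[OF P_closed(4) p] eval_zero[OF \<psi>_affine[OF p]] by simp
    qed
    then show ?thesis using \<psi>_affine[OF p] by (simp add: S(2) zero_set_def)
  qed
  then have map: "\<psi> \<in> snd Y \<rightarrow>\<^sub>E snd Z" by (auto simp: \<psi>_def)
  have "\<psi> \<in> AS_hom K A B Y Z"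
  proof (rule AS_homI[OF Z map])
    show "\<exists>g'\<in>carrier (P ?n). \<forall>p\<in>snd Y. eval ?n g' p = eval ?m g (\<psi> p)"
      if "g \<in> carrier (P ?m)" for g
      using that r(1) eval_r by (intro bexI[of _ "r g"]) simp_all
  qed (simp add: e)
  moreover have "pullback Z Y \<psi> = h"
  proof (rule pullback_eqI[OF Z])
    show "h \<in> extensional (carrier (\<Gamma> Z))"
      using hA by (auto simp: A_hom_def lie_hom_def PiE_iff)
    show "pullback Z Y \<psi> (cls Z g) = h (cls Z g)" if "g \<in> carrier (P ?m)" for g
      using pullback_cls[OF Z _ that, of \<psi> Y "r g"] map that r(2) eval_r by auto
  qed
  ultimately show ?thesis by blast
qed

section \<open>Functoriality of the pullback, and the equivalence\<close>

lemma pullback_Id: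
  assumes Y: "Y \<in> alg"
  shows "pullback Y Y (restrict id (snd Y)) = restrict id (carrier (\<Gamma> Y))"
proof (rule pullback_eqI[OF Y])
  fix g assume g: "g \<in> carrier (P (fst Y))"
  have "pullback Y Y (restrict id (snd Y)) (cls Y g) = cls Y g"
    by (rule pullback_cls[OF Y _ g]) auto
  then show "pullback Y Y (restrict id (snd Y)) (cls Y g) = restrict id (carrier (\<Gamma> Y)) (cls Y g)"
    using g by (simp add: \<Gamma>_ops(1)[OF Y])
qed simp

text \<open>Both sides send the class of \<open>h\<close> to that of \<open>h''\<close>, which
  arises by pulling \<open>h\<close> back along \<open>\<psi>\<close> and then along
  \<open>\<phi>\<close>.\<close>

lemma pullback_compose:
  assumes X: "X \<in> alg" and Y: "Y \<in> alg" and Z: "Z \<in> alg"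
    and \<phi>: "\<phi> \<in> AS_hom K A B X Y" and \<psi>: "\<psi> \<in> AS_hom K A B Y Z"
  shows "pullback Z X (compose (snd X) \<psi> \<phi>) =
    compose (carrier (\<Gamma> Z)) (pullback Y X \<phi>) (pullback Z Y \<psi>)"
proof (rule pullback_eqI[OF Z])
  fix h assume h: "h \<in> carrier (P (fst Z))"
  have maps: "\<phi> \<in> snd X \<rightarrow> snd Y" "\<psi> \<in> snd Y \<rightarrow> snd Z"
    using \<phi> \<psi> by (auto simp: AS_hom_def)
  obtain h' where h': "h' \<in> carrier (P (fst Y))"
    "\<And>p. p \<in> snd Y \<Longrightarrow> eval (fst Y) h' p = eval (fst Z) h (\<psi> p)"
    using AS_hom_subst[OF Y \<psi> h] by blast
  obtain h'' where h'': "h'' \<in> carrier (P (fst X))"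
    "\<And>p. p \<in> snd X \<Longrightarrow> eval (fst X) h'' p = eval (fst Y) h' (\<phi> p)"
    using AS_hom_subst[OF X \<phi> h'(1)] by blast
  have "pullback Z X (compose (snd X) \<psi> \<phi>) (cls Z h) = cls X h''"
    by (rule pullback_cls[OF Z _ h]) (use maps h' h'' in \<open>auto simp: compose_eq\<close>)
  then show "pullback Z X (compose (snd X) \<psi> \<phi>) (cls Z h) =
      compose (carrier (\<Gamma> Z)) (pullback Y X \<phi>) (pullback Z Y \<psi>) (cls Z h)"
    using h pullback_cls[OF Z maps(2) h h'(2)] pullback_cls[OF Y maps(1) h'(1) h''(2)]
    by (simp add: compose_eq \<Gamma>_ops(1)[OF Z])
qed simp

lemma pullback_functor: "cat_functor (op_cat (AS K A B)) (CA K A B) \<Gamma> pullback"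
proof (intro cat_functor.intro cat_functor_axioms.intro category_op_cat category_AS category_CA)
qed (auto simp: op_cat_def AS_def CA_def pullback_in_Hom pullback_Id pullback_compose)

lemma contravariantly_equivalent_AS_CA: "contravariantly_equivalent (AS K A B) (CA K A B)"
  unfolding contravariantly_equivalent_def
proof (rule cat_functor.equivalent_cats_if_bij[OF pullback_functor])
  show "\<Gamma> ` Ob (op_cat (AS K A B)) = Ob (CA K A B)"
    by (simp add: op_cat_def AS_def CA_def)
  show "bij_betw (pullback X Y) (Hom (op_cat (AS K A B)) X Y) (Hom (CA K A B) (\<Gamma> X) (\<Gamma> Y))"
    if "X \<in> Ob (op_cat (AS K A B))" "Y \<in> Ob (op_cat (AS K A B))" for X Y
    using that pullback_inj[of Y X] pullback_surj[of Y X] pullback_in_Hom[of Y X]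
    by (auto simp: op_cat_def AS_def CA_def bij_betw_def)
qed

end

theorem corollary7p3:
  fixes K :: "('k, 'm) ring_scheme"
    and A :: "('k, 'a, 'p) module_scheme"
    and B :: "('k, 'b, 'a, 'q) alie_scheme"
  assumes "field K"
    and "lie_algebra K A"
    and "A_lie_algebra K A B"
  shows "category (AS K A B) \<and> category (CA K A B) \<and>
    contravariantly_equivalent (AS K A B) (CA K A B)"
proof -
  interpret A_lie K A B by standard fact
  show ?thesis
    by (intro conjI category_AS category_CA contravariantly_equivalent_AS_CA)
qed

end
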